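(* There is an absolute constant $c_2\le 4$ such that the following holds. Fix a step $n\ge q$ of the fully discrete scheme in the context, in which $\mathbf x^{n-1}$, $\bar{\mathbf v}^n$ and the polynomial $p^n$ are given. Let $\bar{\mathbf x}^n=\mathbf x^{n-1}+\tau\bar{\mathbf v}^n$, let $\bar v_h^n\in S_h[\bar{\mathbf x}^n]^3$ be the finite element function on $\Gamma_h[\bar{\mathbf x}^n]$ with nodal vector $\bar{\mathbf v}^n$, and set $$\delta^n=\Big|\frac1\tau\big(\mathcal E_h[\bar{\mathbf x}^n]-\mathcal E_h[\mathbf x^{n-1}]\big)+\frac1\tau\int_{t_{n-1}}^{t_n}p^n(t)^2\,dt\Big|,\qquad \sigma^n=\Big|\int_{\Gamma_h[\bar{\mathbf x}^n]}\nabla_{\Gamma_h[\bar{\mathbf x}^n]}\cdot\bar v_h^n\Big|.$$ Assume $\sigma^n>0$ and set $$\eta^n=3\left(\frac{c_2\,\|\nabla_{\Gamma_h[\bar{\mathbf x}^n]}\bar v_h^n\|_{L^2(\Gamma_h[\bar{\mathbf x}^n])^{3\times3}}}{\sigma^n}\right)^2.$$ Assume that the step size $\tau$ and the defect $\delta^n$ are small enough that $$\tau\delta^n\eta^n\le\tfrac14,\quad\text{so that } \tau\delta^n\eta^n=\gamma^n(1-\gamma^n)\text{ for some }\gamma^n\in(0,\tfrac12],$$ and that $$\rho^n:=\frac{\delta^n}{\sigma^n(1-\gamma^n)}\quad\text{satisfies}\quad \tau\rho^n\,\|\nabla_{\Gamma_h[\bar{\mathbf x}^n]}\bar v_h^n\|_{L^\infty(\Gamma_h[\bar{\mathbf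 x}^n])}\le\tfrac12.$$ Then there exists a unique Lagrange multiplier $\lambda^n$ with $|\lambda^n|\le\rho^n$ such that $$\frac1\tau(\mathbf x^n-\mathbf x^{n-1})=(1+\lambda^n)\bar{\mathbf v}^n\quad\text{and}\quad \mathcal E_h[\mathbf x^n]-\mathcal E_h[\mathbf x^{n-1}]=-\int_{t_{n-1}}^{t_n}p^n(t)^2\,dt$$ are satisfied. In particular, the area decreases: $\mathcal E_h[\mathbf x^n]\le\mathcal E_h[\mathbf x^{n-1}]$. Moreover, the simplified Newton method for $\lambda^n$ with initial iterate $0$ converges linearly to $\lambda^n$ with convergence factor $\gamma^n$.
   Context: **Finite element surfaces.** A nodal vector $\mathbf x=(x_1,\dots,x_N)\in\mathbb R^{3N}$ determines a closed piecewise curved triangulated surface $\Gamma_h[\mathbf x]\subset\mathbb R^3$ (fixed connectivity), each curved triangle being the image of the flat reference triangle under a polynomial map of degree $k$ determined by its nodes. $S_h[\mathbf x]$ is the space of globally continuous functions on $\Gamma_h[\mathbf x]$ whose piecewise pullback to the reference triangle is a polynomial of degree $k$; such a function is determined by its nodal values at $x_1,\dots,x_N$. $\nabla_{\Gamma_h[\mathbf x]}$ is the (piecewise) surface gradient, $\nabla_{\Gamma_h[\mathbf x]}\cdot$ the surface divergence. $\mathcal E_h[\mathbf x]=\int_{\Gamma_h[\mathbf x]}1$ is the area. $\mathbf M(\mathbf x)_{ij}=\int_{\Gamma_h[\mathbf x]}\phi_i[\mathbf x]\phi_j[\mathbf x]$ and $\mathbf A(\mathbf x)_{ij}=\int_{\Gamma_h[\mathbf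 x]}\nabla_{\Gamma_h[\mathbf x]}\phi_i[\mathbf x]\cdot\nabla_{\Gamma_h[\mathbf x]}\phi_j[\mathbf x]$ with the nodal basis $\phi_j[\mathbf x]$ of $S_h[\mathbf x]$ (used blockwise for vector-valued functions). **Scheme** (for mean curvature flow; normal $\nu$, mean curvature $H$). Step size $\tau>0$, $t_n=n\tau$, $q$ the number of steps, $2\le q\le5$. Coefficients: $\sum_{j=0}^q\delta_j\zeta^j=\sum_{\ell=1}^q\frac1\ell(1-\zeta)^\ell$; $\sum_{j=0}^{q-1}\gamma_j\zeta^j=(1-(1-\zeta)^q)/\zeta$; $\beta_j=\frac1\tau\int_{t_{n-1}}^{t_n}L_j^n(t)dt$ with $L_j^n$ the degree-$q$ Lagrange polynomials for nodes $t_n,\dots,t_{n-q}$. $\dot{\mathbf u}^n=\frac1\tau\sum_{j=0}^q\delta_j\mathbf u^{n-j}$, $\widetilde{\mathbf x}^n=\sum_{j=0}^{q-1}\gamma_j\mathbf x^{n-1-j}$ for $n\ge q$, $\widetilde{\mathbf x}^n=\mathbf x^n$ for $n\le q-1$, similarly $\widetilde{\mathbf u}^n$; $\bar{\mathbf v}^n=\sum_{j=0}^q\beta_j\mathbf v^{n-j}$. In step $n\ge q$ one first computes $\mathbf u^n=(\boldsymbol\nu^n;\mathbf H^n)\in\mathbb R^{4N}$ from $\mathbf M(\widetilde{\mathbf x}^n)\dot{\mathbf u}^n+\mathbf A(\widetilde{\mathbf x}^n)\mathbf u^n=\mathbf f(\widetilde{\mathbf x}^n,\widetilde{\mathbf u}^n)$,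 where $\mathbf f(\mathbf x,\mathbf u)|_{j+(\ell-1)N}=\int_{\Gamma_h[\mathbf x]}|\nabla_{\Gamma_h[\mathbf x]}\nu_h|^2(u_h)_\ell\phi_j[\mathbf x]$ for $u_h=(\nu_h;H_h)$ with nodal vector $\mathbf u$; then $\mathbf v^n$ by the nodewise product $\mathbf v^n_i=-H_i^n\nu_i^n$; and finally $\mathbf x^n$ and $\lambda^n\in\mathbb R$ are sought from the two equations displayed in the claim. Here $p^n$ is the interpolation polynomial through the points $(t_{n-j},\|H_h^{n-j}\|_{L^2(\Gamma_h[\widetilde{\mathbf x}^{n-j}])})$, $0\le j\le q$, where $\|H_h^{m}\|_{L^2(\Gamma_h[\widetilde{\mathbf x}^{m}])}=((\mathbf H^{m})^T\mathbf M(\widetilde{\mathbf x}^{m})\mathbf H^{m})^{1/2}$. **Simplified Newton method.** With $f(\lambda)=\frac1\tau(\mathcal E_h[\bar{\mathbf x}^n+\tau\lambda\bar{\mathbf v}^n]-\mathcal E_h[\mathbf x^{n-1}])+\frac1\tau\int_{t_{n-1}}^{t_n}p^n(t)^2dt$, it is the iteration $\lambda_{j+1}=\lambda_j-f(\lambda_j)/f'(0)$, $j\ge0$, $\lambda_0=0$. *)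

theory Defs
  imports "HOL-Analysis.Analysis" "HOL-Computational_Algebra.Polynomial"
begin

section \<open>Reference triangle and nodal basis of degree k\<close>

definition ref_triangle :: "(real^2) set" where
  "ref_triangle = {\<xi>. 0 \<le> \<xi>$1 \<and> 0 \<le> \<xi>$2 \<and> \<xi>$1 + \<xi>$2 \<le> 1}"

text \<open>The index \<open>(a, b)\<close> stands for the Lagrange node \<open>(a/k, b/k)\<close> of the reference triangle.\<close>

definition loc_idx :: "nat \<Rightarrow> (nat \<times> nat) set" where
  "loc_idx k = {(a, b). a + b \<le> k}"

definition loc_node :: "nat \<Rightarrow> nat \<times> nat \<Rightarrow> real^2" where
  "loc_node k \<alpha> = vector [real (fst \<alpha>) / real k, real (snd \<alpha>) / real k]"

text \<open>The factor \<open>\<Prod>i<a. (k s - i) / (a - i)\<close> has degree \<open>a\<close>, vanishes at \<open>s = 0, 1/k, \<dots>, (a-1)/k\<close>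
  and equals 1 at \<open>s = a/k\<close>. The product over the three barycentric coordinates is the
  polynomial of degree \<open>k\<close> that is 1 at the node \<open>\<alpha>\<close> and 0 at all other nodes.\<close>

definition lag_factor :: "nat \<Rightarrow> nat \<Rightarrow> real \<Rightarrow> real" where
  "lag_factor k a s = (\<Prod>i<a. (real k * s - real i) / (real a - real i))"

definition loc_basis :: "nat \<Rightarrow> nat \<times> nat \<Rightarrow> real^2 \<Rightarrow> real" where
  "loc_basis k \<alpha> \<xi> = lag_factor k (fst \<alpha>) (\<xi>$1) * lag_factor k (snd \<alpha>) (\<xi>$2)
     * lag_factor k (k - fst \<alpha> - snd \<alpha>) (1 - \<xi>$1 - \<xi>$2)"

lemma lag_factor_same: "k > 0 \<Longrightarrow> lag_factor k a (real a / real k) = 1"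
  unfolding lag_factor_def by (intro prod.neutral) auto

lemma lag_factor_less: "k > 0 \<Longrightarrow> b < a \<Longrightarrow> lag_factor k a (real b / real k) = 0"
  unfolding lag_factor_def by (intro prod_zero) auto

lemma loc_basis_nodal:
  assumes "k > 0" "\<alpha> \<in> loc_idx k" "\<beta> \<in> loc_idx k"
  shows "loc_basis k \<alpha> (loc_node k \<beta>) = (if \<alpha> = \<beta> then 1 else 0)"
proof -
  obtain a b where \<alpha>: "\<alpha> = (a, b)" "a + b \<le> k"
    using assms(2) by (auto simp: loc_idx_def)
  obtain a' b' where \<beta>: "\<beta> = (a', b')" "a' + b' \<le> k"
    using assms(3) by (auto simp: loc_idx_def)
  have bary: "1 - real a' / real k - real b' / real k = real (k - a' - b') / real k"
    using \<beta>(2) assms(1) by (simp add: field_simps of_nat_diff)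
  have eq: "loc_basis k \<alpha> (loc_node k \<beta>) =
      lag_factor k a (real a' / real k) * lag_factor k b (real b' / real k)
      * lag_factor k (k - a - b) (real (k - a' - b') / real k)"
    by (simp add: loc_basis_def loc_node_def \<alpha> \<beta> bary)
  show ?thesis
  proof (cases "\<alpha> = \<beta>")
    case True
    then show ?thesis using eq lag_factor_same[OF assms(1)] \<alpha>(1) \<beta>(1) by simp
  next
    case False
    then have "a' < a \<or> b' < b \<or> k - a' - b' < k - a - b"
      using \<alpha> \<beta> by auto
    then show ?thesis using eq False lag_factor_less[OF assms(1)] by auto
  qed
qed

section \<open>Closed triangulations\<close>

text \<open>The connectivity: nodes are numbered by \<open>i < nnodes T\<close>, curved triangles by
  \<open>e < nelems T\<close>, and \<open>gnode T e \<alpha>\<close> is the global number of the local node \<open>\<alpha>\<close> of \<open>e\<close>.\<close>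

record fe_mesh =
  mdeg :: nat
  nnodes :: nat
  nelems :: nat
  gnode :: "nat \<Rightarrow> nat \<times> nat \<Rightarrow> nat"

definition elem_nodes :: "fe_mesh \<Rightarrow> nat \<Rightarrow> nat set" where
  "elem_nodes T e = gnode T e ` loc_idx (mdeg T)"

text \<open>\<open>edge_idx k l s\<close> for \<open>s = 0, \<dots>, k\<close> runs through the nodes on the edge \<open>l \<in> {0, 1, 2}\<close>.\<close>

definition edge_idx :: "nat \<Rightarrow> nat \<Rightarrow> nat \<Rightarrow> nat \<times> nat" where
  "edge_idx k l s = (if l = 0 then (s, 0) else if l = 1 then (k - s, s) else (0, k - s))"

definition vert_idx :: "nat \<Rightarrow> (nat \<times> nat) set" where
  "vert_idx k = {(0, 0), (k, 0), (0, k)}"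

definition edge_nodes :: "fe_mesh \<Rightarrow> nat \<Rightarrow> nat \<Rightarrow> nat set" where
  "edge_nodes T e l = (\<lambda>s. gnode T e (edge_idx (mdeg T) l s)) ` {..mdeg T}"

definition edges_match :: "fe_mesh \<Rightarrow> nat \<Rightarrow> nat \<Rightarrow> nat \<Rightarrow> nat \<Rightarrow> bool" where
  "edges_match T e l e' l' \<longleftrightarrow>
     (\<forall>s\<le>mdeg T. gnode T e (edge_idx (mdeg T) l s) = gnode T e' (edge_idx (mdeg T) l' s)) \<or>
     (\<forall>s\<le>mdeg T. gnode T e (edge_idx (mdeg T) l s) = gnode T e' (edge_idx (mdeg T) l' (mdeg T - s)))"

text \<open>Conforming triangulation of a closed surface: distinct triangles meet in nothing, a common
  vertex or a common edge; every edge belongs to exactly two triangles; the triangles around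
  a vertex are connected through edges containing that vertex.\<close>

definition closed_triangulation :: "fe_mesh \<Rightarrow> bool" where
  "closed_triangulation T \<longleftrightarrow>
     1 \<le> mdeg T \<and>
     (\<forall>e<nelems T. inj_on (gnode T e) (loc_idx (mdeg T))) \<and>
     (\<Union>e<nelems T. elem_nodes T e) = {..<nnodes T} \<and>
     (\<forall>e<nelems T. \<forall>e'<nelems T. e \<noteq> e' \<longrightarrow>
        elem_nodes T e \<inter> elem_nodes T e' = {} \<or>
        (\<exists>\<alpha>\<in>vert_idx (mdeg T). \<exists>\<beta>\<in>vert_idx (mdeg T). gnode T e \<alpha> = gnode T e' \<beta> \<and>
           elem_nodes T e \<inter> elem_nodes T e' = {gnode T e \<alpha>}) \<or>
        (\<exists>l<3. \<exists>l'<3. edges_match T e l e' l' \<and>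
           elem_nodes T e \<inter> elem_nodes T e' = edge_nodes T e l)) \<and>
     (\<forall>e<nelems T. \<forall>l<3. \<exists>!e'. e' < nelems T \<and> e' \<noteq> e \<and> (\<exists>l'<3. edges_match T e l e' l')) \<and>
     (\<forall>e<nelems T. \<forall>e'<nelems T. \<forall>i \<in> gnode T e ` vert_idx (mdeg T) \<inter> gnode T e' ` vert_idx (mdeg T).
        (e, e') \<in> {(c, d). c < nelems T \<and> d < nelems T \<and>
                     (\<exists>l<3. \<exists>l'<3. edges_match T c l d l' \<and> i \<in> edge_nodes T c l)}\<^sup>*)"

section \<open>Finite element functions and surface calculus\<close>

text \<open>A nodal vector in \<open>\<real>\<^sup>3\<^sup>N\<close> is a function \<open>x :: nat \<Rightarrow> real^3\<close> of which only the values at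
  \<open>i < nnodes T\<close> matter. Functions on \<open>\<Gamma>\<^sub>h[x]\<close> are represented by their pullbacks
  \<open>nat \<Rightarrow> real^2 \<Rightarrow> _\<close> to the reference triangle, one for each triangle \<open>e\<close>.

  \<open>fe_fun T w\<close> is the pullback of the function in \<open>S\<^sub>h[x]\<close> with nodal vector \<open>w\<close>; it does not
  depend on \<open>x\<close>. For \<open>w = x\<close> it is the parametrization of the surface \<open>\<Gamma>\<^sub>h[x]\<close> itself. Continuity
  across edges holds because on an edge \<open>loc_basis k \<alpha>\<close> vanishes unless \<open>\<alpha>\<close> lies on that edge.\<close>

definition fe_fun :: "fe_mesh \<Rightarrow> (nat \<Rightarrow> 'v::real_vector) \<Rightarrow> nat \<Rightarrow> real^2 \<Rightarrow> 'v" where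
  "fe_fun T w e \<xi> = (\<Sum>\<alpha>\<in>loc_idx (mdeg T). loc_basis (mdeg T) \<alpha> \<xi> *\<^sub>R w (gnode T e \<alpha>))"

lemma fe_fun_nodal:
  assumes "mdeg T > 0" "\<beta> \<in> loc_idx (mdeg T)"
  shows "fe_fun T w e (loc_node (mdeg T) \<beta>) = w (gnode T e \<beta>)"
proof -
  have fin: "finite (loc_idx (mdeg T))"
    by (rule finite_subset[of _ "{..mdeg T} \<times> {..mdeg T}"]) (auto simp: loc_idx_def)
  have "fe_fun T w e (loc_node (mdeg T) \<beta>) =
      (\<Sum>\<alpha>\<in>loc_idx (mdeg T). if \<alpha> = \<beta> then w (gnode T e \<alpha>) else 0)"
    unfolding fe_fun_def by (intro sum.cong) (auto simp: loc_basis_nodal assms)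
  then show ?thesis using fin assms(2) by simp
qed

definition nodal_basis :: "fe_mesh \<Rightarrow> nat \<Rightarrow> nat \<Rightarrow> real^2 \<Rightarrow> real" where
  "nodal_basis T j = fe_fun T (\<lambda>i. if i = j then 1 else 0)"

definition param_jac :: "fe_mesh \<Rightarrow> (nat \<Rightarrow> real^3) \<Rightarrow> nat \<Rightarrow> real^2 \<Rightarrow> real^2^3" where
  "param_jac T x e \<xi> = jacobian (fe_fun T x e) (at \<xi>)"

definition first_form :: "fe_mesh \<Rightarrow> (nat \<Rightarrow> real^3) \<Rightarrow> nat \<Rightarrow> real^2 \<Rightarrow> real^2^2" where
  "first_form T x e \<xi> = transpose (param_jac T x e \<xi>) ** param_jac T x e \<xi>"

text \<open>Every curved triangle is nondegenerate (the parametrization is an immersion up to the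
  boundary), so that the tangent plane and the surface gradient exist.\<close>

definition regular_surface :: "fe_mesh \<Rightarrow> (nat \<Rightarrow> real^3) \<Rightarrow> bool" where
  "regular_surface T x \<longleftrightarrow>
     (\<forall>e<nelems T. \<forall>\<xi>\<in>ref_triangle. inj (\<lambda>h. param_jac T x e \<xi> *v h))"

definition surf_integral ::
    "fe_mesh \<Rightarrow> (nat \<Rightarrow> real^3) \<Rightarrow> (nat \<Rightarrow> real^2 \<Rightarrow> 'v::euclidean_space) \<Rightarrow> 'v" where
  "surf_integral T x g =
     (\<Sum>e<nelems T. integral ref_triangle (\<lambda>\<xi>. sqrt (det (first_form T x e \<xi>)) *\<^sub>R g e \<xi>))"

definition area :: "fe_mesh \<Rightarrow> (nat \<Rightarrow> real^3) \<Rightarrow> real" where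
  "area T x = surf_integral T x (\<lambda>_ _. 1)"

definition surf_grad ::
    "fe_mesh \<Rightarrow> (nat \<Rightarrow> real^3) \<Rightarrow> (nat \<Rightarrow> real^2 \<Rightarrow> real) \<Rightarrow> nat \<Rightarrow> real^2 \<Rightarrow> real^3" where
  "surf_grad T x w e \<xi> =
     param_jac T x e \<xi> *v (matrix_inv (first_form T x e \<xi>) *v
       (\<chi> i. frechet_derivative (w e) (at \<xi>) (axis i 1)))"

text \<open>For vector-valued functions, column \<open>j\<close> is the surface gradient of component \<open>j\<close>.\<close>

definition surf_grad_vec ::
    "fe_mesh \<Rightarrow> (nat \<Rightarrow> real^3) \<Rightarrow> (nat \<Rightarrow> real^2 \<Rightarrow> real^3) \<Rightarrow> nat \<Rightarrow> real^2 \<Rightarrow> real^3^3" where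
  "surf_grad_vec T x w e \<xi> = (\<chi> i j. surf_grad T x (\<lambda>e' \<zeta>. w e' \<zeta> $ j) e \<xi> $ i)"

definition surf_div ::
    "fe_mesh \<Rightarrow> (nat \<Rightarrow> real^3) \<Rightarrow> (nat \<Rightarrow> real^2 \<Rightarrow> real^3) \<Rightarrow> nat \<Rightarrow> real^2 \<Rightarrow> real" where
  "surf_div T x w e \<xi> = trace (surf_grad_vec T x w e \<xi>)"

text \<open>On \<open>real^3^3\<close> the library norm is the Frobenius norm.\<close>

definition L2_norm_surf ::
    "fe_mesh \<Rightarrow> (nat \<Rightarrow> real^3) \<Rightarrow> (nat \<Rightarrow> real^2 \<Rightarrow> 'v::real_normed_vector) \<Rightarrow> real" where
  "L2_norm_surf T x g = sqrt (surf_integral T x (\<lambda>e \<xi>. (norm (g e \<xi>))\<^sup>2))"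

text \<open>Essential supremum. On a regular surface the null sets of the surface measure
  correspond to the Lebesgue null sets of the reference triangle.\<close>

definition Linf_norm_surf :: "fe_mesh \<Rightarrow> (nat \<Rightarrow> real^2 \<Rightarrow> 'v::real_normed_vector) \<Rightarrow> real" where
  "Linf_norm_surf T g =
     Inf {C. 0 \<le> C \<and> (\<forall>e<nelems T. AE \<xi> in lborel. \<xi> \<in> ref_triangle \<longrightarrow> norm (g e \<xi>) \<le> C)}"

definition mass_matrix :: "fe_mesh \<Rightarrow> (nat \<Rightarrow> real^3) \<Rightarrow> nat \<Rightarrow> nat \<Rightarrow> real" where
  "mass_matrix T x i j = surf_integral T x (\<lambda>e \<xi>. nodal_basis T i e \<xi> * nodal_basis T j e \<xi>)"

definition stiffness_matrix :: "fe_mesh \<Rightarrow> (nat \<Rightarrow> real^3) \<Rightarrow> nat \<Rightarrow> nat \<Rightarrow> real" where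
  "stiffness_matrix T x i j = surf_integral T x
     (\<lambda>e \<xi>. surf_grad T x (nodal_basis T i) e \<xi> \<bullet> surf_grad T x (nodal_basis T j) e \<xi>)"

section \<open>The fully discrete scheme\<close>

text \<open>\<open>u = (\<nu>; H)\<close> is stored nodewise as \<open>u i = (\<nu>\<^sub>i, H\<^sub>i)\<close> in \<open>real^3 \<times> real\<close>, so that block
  matrices act through scalar multiplication of these pairs. Sequences in time have the time
  index as their first argument.\<close>

definition load_vector ::
    "fe_mesh \<Rightarrow> (nat \<Rightarrow> real^3) \<Rightarrow> (nat \<Rightarrow> (real^3) \<times> real) \<Rightarrow> nat \<Rightarrow> (real^3) \<times> real" where
  "load_vector T x u j = surf_integral T x
     (\<lambda>e \<xi>. ((norm (surf_grad_vec T x (fe_fun T (\<lambda>i. fst (u i))) e \<xi>))\<^sup>2 * nodal_basis T j e \<xi>)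
              *\<^sub>R fe_fun T u e \<xi>)"

definition delta_coeff :: "nat \<Rightarrow> nat \<Rightarrow> real" where
  "delta_coeff q j = coeff (\<Sum>l=1..q. smult (1 / real l) ([:1, -1:] ^ l)) j"

definition gamma_coeff :: "nat \<Rightarrow> nat \<Rightarrow> real" where
  "gamma_coeff q j = coeff ((1 - [:1, -1:] ^ q) div [:0, 1:]) j"

definition tgrid :: "real \<Rightarrow> nat \<Rightarrow> real" where
  "tgrid \<tau> n = real n * \<tau>"

definition time_lagrange :: "real \<Rightarrow> nat \<Rightarrow> nat \<Rightarrow> nat \<Rightarrow> real \<Rightarrow> real" where
  "time_lagrange \<tau> q n j t =
     (\<Prod>i\<in>{..q} - {j}. (t - tgrid \<tau> (n - i)) / (tgrid \<tau> (n - j) - tgrid \<tau> (n - i)))"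

definition beta_coeff :: "real \<Rightarrow> nat \<Rightarrow> nat \<Rightarrow> nat \<Rightarrow> real" where
  "beta_coeff \<tau> q n j = (1 / \<tau>) * integral {tgrid \<tau> (n - 1)..tgrid \<tau> n} (time_lagrange \<tau> q n j)"

definition bdf_deriv ::
    "real \<Rightarrow> nat \<Rightarrow> (nat \<Rightarrow> nat \<Rightarrow> 'v::real_vector) \<Rightarrow> nat \<Rightarrow> nat \<Rightarrow> 'v" where
  "bdf_deriv \<tau> q u n i = (1 / \<tau>) *\<^sub>R (\<Sum>j\<le>q. delta_coeff q j *\<^sub>R u (n - j) i)"

definition extrapolation ::
    "nat \<Rightarrow> (nat \<Rightarrow> nat \<Rightarrow> 'v::real_vector) \<Rightarrow> nat \<Rightarrow> nat \<Rightarrow> 'v" where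
  "extrapolation q w n i =
     (if q \<le> n then (\<Sum>j<q. gamma_coeff q j *\<^sub>R w (n - 1 - j) i) else w n i)"

definition time_average ::
    "real \<Rightarrow> nat \<Rightarrow> (nat \<Rightarrow> nat \<Rightarrow> 'v::real_vector) \<Rightarrow> nat \<Rightarrow> nat \<Rightarrow> 'v" where
  "time_average \<tau> q v n i = (\<Sum>j\<le>q. beta_coeff \<tau> q n j *\<^sub>R v (n - j) i)"

definition H_norm ::
    "fe_mesh \<Rightarrow> nat \<Rightarrow> (nat \<Rightarrow> nat \<Rightarrow> real^3) \<Rightarrow> (nat \<Rightarrow> nat \<Rightarrow> (real^3) \<times> real) \<Rightarrow> nat \<Rightarrow> real" where
  "H_norm T q x u m = sqrt (\<Sum>i<nnodes T. \<Sum>j<nnodes T.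
     snd (u m i) * mass_matrix T (extrapolation q x m) i j * snd (u m j))"

text \<open>The interpolation polynomial \<open>p\<^sup>n\<close> in Lagrange form.\<close>

definition p_interp ::
    "fe_mesh \<Rightarrow> real \<Rightarrow> nat \<Rightarrow> (nat \<Rightarrow> nat \<Rightarrow> real^3) \<Rightarrow> (nat \<Rightarrow> nat \<Rightarrow> (real^3) \<times> real) \<Rightarrow>
      nat \<Rightarrow> real \<Rightarrow> real" where
  "p_interp T \<tau> q x u n t = (\<Sum>j\<le>q. H_norm T q x u (n - j) * time_lagrange \<tau> q n j t)"

definition dissipation ::
    "fe_mesh \<Rightarrow> real \<Rightarrow> nat \<Rightarrow> (nat \<Rightarrow> nat \<Rightarrow> real^3) \<Rightarrow> (nat \<Rightarrow> nat \<Rightarrow> (real^3) \<times> real) \<Rightarrow> nat \<Rightarrow> real" where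
  "dissipation T \<tau> q x u n =
     integral {tgrid \<tau> (n - 1)..tgrid \<tau> n} (\<lambda>t. (p_interp T \<tau> q x u n t)\<^sup>2)"

text \<open>First half of step \<open>n\<close>: computation of \<open>u\<^sup>n\<close> and \<open>v\<^sup>n\<close>.\<close>

definition velocity_step ::
    "fe_mesh \<Rightarrow> real \<Rightarrow> nat \<Rightarrow> (nat \<Rightarrow> nat \<Rightarrow> real^3) \<Rightarrow> (nat \<Rightarrow> nat \<Rightarrow> (real^3) \<times> real) \<Rightarrow>
      (nat \<Rightarrow> nat \<Rightarrow> real^3) \<Rightarrow> nat \<Rightarrow> bool" where
  "velocity_step T \<tau> q x u v n \<longleftrightarrow>
     (\<forall>i<nnodes T.
        (\<Sum>j<nnodes T. mass_matrix T (extrapolation q x n) i j *\<^sub>R bdf_deriv \<tau> q u n j)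
        + (\<Sum>j<nnodes T. stiffness_matrix T (extrapolation q x n) i j *\<^sub>R u n j)
        = load_vector T (extrapolation q x n) (extrapolation q u n) i) \<and>
     (\<forall>i<nnodes T. v n i = - snd (u n i) *\<^sub>R fst (u n i))"

text \<open>Second half of step \<open>n\<close>: the two equations for the multiplier \<open>l\<close> and the new nodal
  vector \<open>X\<close>. For \<open>n \<ge> q\<close> they refer only to \<open>x m\<close> with \<open>m < n\<close>.\<close>

definition position_equations ::
    "fe_mesh \<Rightarrow> real \<Rightarrow> nat \<Rightarrow> (nat \<Rightarrow> nat \<Rightarrow> real^3) \<Rightarrow> (nat \<Rightarrow> nat \<Rightarrow> (real^3) \<times> real) \<Rightarrow>
      (nat \<Rightarrow> nat \<Rightarrow> real^3) \<Rightarrow> nat \<Rightarrow> real \<Rightarrow> (nat \<Rightarrow> real^3) \<Rightarrow> bool" where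
  "position_equations T \<tau> q x u v n l X \<longleftrightarrow>
     (\<forall>i<nnodes T. (1 / \<tau>) *\<^sub>R (X i - x (n - 1) i) = (1 + l) *\<^sub>R time_average \<tau> q v n i) \<and>
     area T X - area T (x (n - 1)) = - dissipation T \<tau> q x u n"

text \<open>The scheme has been carried out up to and including the computation of \<open>v\<^sup>n\<close>; the values
  with time index below \<open>q\<close> are arbitrary starting values.\<close>

definition scheme_until ::
    "fe_mesh \<Rightarrow> real \<Rightarrow> nat \<Rightarrow> (nat \<Rightarrow> nat \<Rightarrow> real^3) \<Rightarrow> (nat \<Rightarrow> nat \<Rightarrow> (real^3) \<times> real) \<Rightarrow>
      (nat \<Rightarrow> nat \<Rightarrow> real^3) \<Rightarrow> nat \<Rightarrow> bool" where
  "scheme_until T \<tau> q x u v n \<longleftrightarrow>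
     (\<forall>m. q \<le> m \<and> m \<le> n \<longrightarrow> velocity_step T \<tau> q x u v m) \<and>
     (\<forall>m. q \<le> m \<and> m < n \<longrightarrow> (\<exists>l. position_equations T \<tau> q x u v m l (x m)))"

fun simplified_newton :: "(real \<Rightarrow> real) \<Rightarrow> nat \<Rightarrow> real" where
  "simplified_newton f 0 = 0"
| "simplified_newton f (Suc j) = simplified_newton f j - f (simplified_newton f j) / deriv f 0"

end

theory Submission
  imports Defs
begin

text \<open>Let \<open>A s\<close> be the area of the surface with nodal vector \<open>xbar + s vbar\<close>. If \<open>e\<^sub>1, e\<^sub>2\<close> is an
  orthonormal basis of a tangent plane of \<open>\<Gamma>\<^sub>h[xbar]\<close> and \<open>B\<^sub>1, B\<^sub>2\<close> are the derivatives of \<open>v\<^sub>h\<close> in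
  these directions, the area element grows by the factor
  \<open>\<bar>(e\<^sub>1 + s B\<^sub>1) \<times> (e\<^sub>2 + s B\<^sub>2)\<bar>\<close>, whose derivative at 0 is \<open>e\<^sub>1 \<bullet> B\<^sub>1 + e\<^sub>2 \<bullet> B\<^sub>2 = div v\<^sub>h\<close>, while
  \<open>\<bar>\<nabla>v\<^sub>h\<bar>\<^sup>2 = \<bar>B\<^sub>1\<bar>\<^sup>2 + \<bar>B\<^sub>2\<bar>\<^sup>2\<close>. As long as \<open>S \<parallel>\<nabla>v\<^sub>h\<parallel>\<^sub>\<infinity> \<le> 1/2\<close>, the deviation of this factor from its
  linearization has Lipschitz constant at most \<open>48 S \<bar>\<nabla>v\<^sub>h\<bar>\<^sup>2\<close> on \<open>[-S, S]\<close>. Integrating over the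
  surface bounds the Lipschitz constant of \<open>s \<mapsto> A s - A' 0 s\<close> by \<open>48 S \<parallel>\<nabla>v\<^sub>h\<parallel>\<^sup>2\<close>, and since \<open>48 = 3 \<cdot> 4\<^sup>2\<close> the
  simplified Newton map is a contraction of \<open>[-\<rho>, \<rho>]\<close> into itself with factor \<open>\<gamma>\<close>.\<close>

unbundle cross3_syntax

section \<open>Expansion of the area element\<close>

text \<open>The norm is never differentiated. The difference of the squared norms is factored on
  both sides, and replacing \<open>N s + N r\<close> by \<open>P *\<^sub>R a\<close> gives exactly
  the linear term. Every part of the remainder carries a factor
  \<open>S * g\<^sup>2\<close>.\<close>

lemma norm_quadratic_expansion:
  fixes a b c :: "'a::real_inner" and g s r S :: real
  assumes a: "norm a = 1" and b: "norm b \<le> 3/2 * g" and c: "norm c \<le> g\<^sup>2 / 2"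
    and g: "0 \<le> g" and S: "S * g \<le> 1/2" and s: "\<bar>s\<bar> \<le> S" and r: "\<bar>r\<bar> \<le> S"
  shows "\<bar>norm (a + s *\<^sub>R b + s\<^sup>2 *\<^sub>R c) - norm (a + r *\<^sub>R b + r\<^sup>2 *\<^sub>R c) - (a \<bullet> b) * (s - r)\<bar>
    \<le> 43 * S * g\<^sup>2 * \<bar>s - r\<bar>"
proof -
  define N where "N t = a + t *\<^sub>R b + t\<^sup>2 *\<^sub>R c" for t
  have S0: "0 \<le> S" using s by simp
  have near: "norm (N t - a) \<le> 7/4 * (S * g)" if t: "\<bar>t\<bar> \<le> S" for t
  proof -
    have "norm (N t - a) \<le> norm (t *\<^sub>R b) + norm (t\<^sup>2 *\<^sub>R c)"
      unfolding N_def by (metis add.assoc add_diff_cancel_left' norm_triangle_ineq)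
    also have "\<dots> = \<bar>t\<bar> * norm b + \<bar>t\<bar>\<^sup>2 * norm c" by simp
    also have "\<dots> \<le> S * (3/2 * g) + S\<^sup>2 * (g\<^sup>2 / 2)"
      by (intro add_mono mult_mono b c t power_mono) (use S0 g in auto)
    also have "\<dots> = 3/2 * (S * g) + (S * g) * (S * g) / 2" by (simp add: power2_eq_square mult_ac)
    also have "\<dots> \<le> 3/2 * (S * g) + (S * g) * (1/2) / 2"
      using mult_left_mono[OF S, of "S * g"] S0 g by (simp add: mult_ac)
    finally show ?thesis by simp
  qed
  \<comment> \<open>From \<open>S * g\<close> at most 1/2 the deviation from \<open>a\<close> is at
    most 7/8, so the curve stays away from the origin and \<open>P\<close> can be divided
    out.\<close>
  have low: "norm (N t) \<ge> 1/8" if t: "\<bar>t\<bar> \<le> S" for t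
    using near[OF t] S a norm_triangle_ineq2[of a "a - N t"] by (simp add: norm_minus_commute)
  have dev: "norm (N t - norm (N t) *\<^sub>R a) \<le> 7/2 * (S * g)" if t: "\<bar>t\<bar> \<le> S" for t
  proof -
    have "norm (N t - norm (N t) *\<^sub>R a) = norm ((N t - a) + (1 - norm (N t)) *\<^sub>R a)"
      by (simp add: algebra_simps)
    also have "\<dots> \<le> norm (N t - a) + \<bar>norm a - norm (N t)\<bar>"
      using norm_triangle_ineq[of "N t - a" "(1 - norm (N t)) *\<^sub>R a"] a by simp
    also have "\<bar>norm a - norm (N t)\<bar> \<le> norm (N t - a)"
      by (metis norm_minus_commute norm_triangle_ineq3)
    finally show ?thesis using near[OF t] by simp
  qed
  define P where "P = norm (N s) + norm (N r)"
  have P: "P \<ge> 1/4" using low[OF s] low[OF r] by (simp add: P_def)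
  have diff: "N s - N r = (s - r) *\<^sub>R (b + (s + r) *\<^sub>R c)"
    by (simp add: N_def algebra_simps power2_eq_square)
  have sq: "(norm (N s) - norm (N r)) * P = (N s - N r) \<bullet> (N s + N r)"
    by (simp add: P_def algebra_simps inner_commute flip: power2_norm_eq_inner power2_eq_square)
  \<comment> \<open>\<open>w\<close> measures how far the two vectors are from the multiples of
    \<open>a\<close> with the same lengths.\<close>
  define w where "w = (N s - norm (N s) *\<^sub>R a) + (N r - norm (N r) *\<^sub>R a)"
  have w: "norm w \<le> 7 * (S * g)"
    unfolding w_def using norm_triangle_ineq[of "N s - norm (N s) *\<^sub>R a" "N r - norm (N r) *\<^sub>R a"]
      dev[OF s] dev[OF r] by simp
  have Nsum: "N s + N r = w + P *\<^sub>R a" by (simp add: w_def P_def algebra_simps)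
  have key: "(norm (N s) - norm (N r) - (a \<bullet> b) * (s - r)) * P
      = (s - r) * (b \<bullet> w + (s + r) * (c \<bullet> (N s + N r)))" (is "?L * P = _ * ?R")
  proof -
    have "(norm (N s) - norm (N r)) * P = (s - r) * (b \<bullet> (N s + N r) + (s + r) * (c \<bullet> (N s + N r)))"
      unfolding sq diff by (simp add: inner_add_left)
    also have "b \<bullet> (N s + N r) = b \<bullet> w + P * (a \<bullet> b)"
      unfolding Nsum by (simp add: inner_add_right inner_commute)
    finally show ?thesis by (simp add: algebra_simps)
  qed
  have "\<bar>?R\<bar> \<le> \<bar>b \<bullet> w\<bar> + \<bar>s + r\<bar> * \<bar>c \<bullet> (N s + N r)\<bar>"
    by (metis abs_mult abs_triangle_ineq)
  also have "\<bar>b \<bullet> w\<bar> \<le> 3/2 * g * (7 * (S * g))"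
    using Cauchy_Schwarz_ineq2[of b w] mult_mono[OF b w] g by simp
  also have "\<bar>s + r\<bar> * \<bar>c \<bullet> (N s + N r)\<bar> \<le> (2 * S) * ((g\<^sup>2 / 2) * P)"
  proof (intro mult_mono)
    have "\<bar>c \<bullet> (N s + N r)\<bar> \<le> norm c * norm (N s + N r)" by (rule Cauchy_Schwarz_ineq2)
    also have "\<dots> \<le> (g\<^sup>2 / 2) * P"
      unfolding P_def by (intro mult_mono c norm_triangle_ineq) auto
    finally show "\<bar>c \<bullet> (N s + N r)\<bar> \<le> (g\<^sup>2 / 2) * P" .
  qed (use s r S0 in auto)
  also have "3/2 * g * (7 * (S * g)) + (2 * S) * ((g\<^sup>2 / 2) * P) = S * g\<^sup>2 * (21/2 + P)"
    by (simp add: power2_eq_square algebra_simps)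
  \<comment> \<open>Since \<open>P\<close> is at least 1/4, 21/2 is at most \<open>42 * P\<close>;
    this is the origin of 43.\<close>
  also have "\<dots> \<le> S * g\<^sup>2 * (43 * P)"
    by (intro mult_left_mono) (use P S0 in auto)
  finally have R: "\<bar>?R\<bar> \<le> 43 * S * g\<^sup>2 * P" by (simp add: algebra_simps)
  have "\<bar>?L\<bar> * P = \<bar>s - r\<bar> * \<bar>?R\<bar>"
    using arg_cong[OF key, of abs] P by (simp add: abs_mult)
  also have "\<dots> \<le> \<bar>s - r\<bar> * (43 * S * g\<^sup>2 * P)" by (intro mult_left_mono R) auto
  finally have "\<bar>?L\<bar> * P \<le> (43 * S * g\<^sup>2 * \<bar>s - r\<bar>) * P" by (simp add: algebra_simps)
  then show ?thesis using P by (simp add: N_def)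
qed

lemma norm_cross_orthonormal:
  fixes e1 e2 :: "real^3"
  assumes "norm e1 = 1" "norm e2 = 1" "e1 \<bullet> e2 = 0"
  shows "norm (e1 \<times> e2) = 1"
  using norm_cross_dot[of e1 e2] assms norm_ge_zero[of "e1 \<times> e2"]
  by (auto simp: power2_eq_1_iff simp del: norm_ge_zero)

text \<open>The cross product is a quadratic polynomial in the parameter with coefficients
  \<open>?a\<close>, \<open>?b\<close>, \<open>?c\<close>. The bound on \<open>?b\<close> comes from
  |B1| + |B2| \<le> sqrt 2 * g, with 3/2 as a rational substitute for sqrt 2.\<close>

lemma parallelogram_area_expansion:
  fixes e1 e2 B1 B2 :: "real^3" and g s r S :: real
  assumes e: "norm e1 = 1" "norm e2 = 1" "e1 \<bullet> e2 = 0"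
    and g: "g\<^sup>2 = (norm B1)\<^sup>2 + (norm B2)\<^sup>2" "0 \<le> g"
    and S: "S * g \<le> 1/2" and s: "\<bar>s\<bar> \<le> S" and r: "\<bar>r\<bar> \<le> S"
  shows "\<bar>norm ((e1 + s *\<^sub>R B1) \<times> (e2 + s *\<^sub>R B2)) - norm ((e1 + r *\<^sub>R B1) \<times> (e2 + r *\<^sub>R B2))
      - (e1 \<bullet> B1 + e2 \<bullet> B2) * (s - r)\<bar> \<le> 48 * S * g\<^sup>2 * \<bar>s - r\<bar>"
proof -
  let ?a = "e1 \<times> e2" and ?b = "e1 \<times> B2 + B1 \<times> e2" and ?c = "B1 \<times> B2"
  have cross_le: "norm (x \<times> y) \<le> norm x * norm y" for x y :: "real^3"
  proof (rule power2_le_imp_le)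
    show "(norm (x \<times> y))\<^sup>2 \<le> (norm x * norm y)\<^sup>2"
      using norm_cross_dot[of x y] zero_le_power2[of "x \<bullet> y"] by linarith
  qed simp
  have a: "norm ?a = 1" by (intro norm_cross_orthonormal e)
  have b: "norm ?b \<le> 3/2 * g"
  proof (rule power2_le_imp_le)
    have "norm ?b \<le> norm B2 + norm B1"
      using norm_triangle_ineq[of "e1 \<times> B2" "B1 \<times> e2"] cross_le[of e1 B2] cross_le[of B1 e2] e by simp
    then have "(norm ?b)\<^sup>2 \<le> (norm B2 + norm B1)\<^sup>2" by (intro power_mono) auto
    also have "\<dots> \<le> 2 * g\<^sup>2"
      using sum_squares_bound[of "norm B2" "norm B1"] by (simp add: g power2_sum)
    also have "\<dots> \<le> (3/2 * g)\<^sup>2" by (simp add: power_mult_distrib power2_eq_square)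
    finally show "(norm ?b)\<^sup>2 \<le> (3/2 * g)\<^sup>2" .
  qed (use g in simp)
  have c: "norm ?c \<le> g\<^sup>2 / 2"
    using cross_le[of B1 B2] sum_squares_bound[of "norm B1" "norm B2"] g by simp
  \<comment> \<open>The Binet-Cauchy identity for the inner product of two cross products produces
    the divergence in the frame.\<close>
  have ab: "?a \<bullet> ?b = e1 \<bullet> B1 + e2 \<bullet> B2"
    using e by (simp add: inner_add_right dot_cross norm_eq_1 inner_commute)
  have expand: "(e1 + t *\<^sub>R B1) \<times> (e2 + t *\<^sub>R B2) = ?a + t *\<^sub>R ?b + t\<^sup>2 *\<^sub>R ?c" for t
    by (simp add: cross_add_left cross_add_right cross_mult_left cross_mult_right algebra_simps power2_eq_square)
  \<comment> \<open>The constant 43 is relaxed to 48 = 3 * 4^2, the value that belongs to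
    \<open>c2 = 4\<close>.\<close>
  have "0 \<le> S * g\<^sup>2 * \<bar>s - r\<bar>" using s by simp
  then show ?thesis
    using norm_quadratic_expansion[OF a b c g(2) S s r] unfolding ab expand by linarith
qed

section \<open>Orthonormal frames of the tangent plane\<close>

text \<open>Gram-Schmidt on the columns of \<open>J\<close>, that is J = E R with R upper triangular
  with entries \<open>p\<close>, \<open>q\<close>, \<open>r\<close>. The columns of W R^-1 are
  \<open>B1\<close> and \<open>B2\<close>; for the Jacobian \<open>W\<close> of a vector field they
  are its derivatives along \<open>e1\<close> and \<open>e2\<close>.\<close>

lemma immersion_frame:
  fixes J W :: "real^2^3"
  assumes inj: "inj (\<lambda>h. J *v h)"
  obtains e1 e2 B1 B2 p q r where "norm e1 = 1" "norm e2 = 1" "e1 \<bullet> e2 = 0" "0 < p" "0 < r"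
    "column 1 J = p *\<^sub>R e1" "column 2 J = q *\<^sub>R e1 + r *\<^sub>R e2"
    "column 1 W = p *\<^sub>R B1" "column 2 W = q *\<^sub>R B1 + r *\<^sub>R B2"
proof -
  define j1 j2 p where "j1 = column 1 J" and "j2 = column 2 J" and "p = norm j1"
  have apply_J: "J *v h = h$1 *\<^sub>R j1 + h$2 *\<^sub>R j2" for h
    by (simp add: matrix_mult_sum sum_2 scalar_mult_eq_scaleR j1_def j2_def)
  have ker: "h = 0" if "J *v h = 0" for h
    using injD[OF inj, of h 0] that by simp
  have p: "p > 0"
  proof (rule ccontr)
    assume "\<not> p > 0"
    then have "J *v (vector [1, 0]) = 0" by (simp add: apply_J p_def)
    from ker[OF this] have "(vector [1, 0] :: real^2) $ 1 = 0" by simp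
    then show False by simp
  qed
  define e1 where "e1 = (1 / p) *\<^sub>R j1"
  define q where "q = e1 \<bullet> j2"
  define r where "r = norm (j2 - q *\<^sub>R e1)"
  have r: "r > 0"
  proof (rule ccontr)
    assume "\<not> r > 0"
    \<comment> \<open>If \<open>r\<close> were 0, then \<open>j2 = q *\<^sub>R e1\<close> would be
      q/p times \<open>j1\<close>.\<close>
    then have "J *v (vector [- q / p, 1]) = 0" by (simp add: apply_J r_def e1_def)
    from ker[OF this] have "(vector [- q / p, 1] :: real^2) $ 2 = 0" by simp
    then show False by simp
  qed
  define e2 where "e2 = (1 / r) *\<^sub>R (j2 - q *\<^sub>R e1)"
  define B1 where "B1 = (1 / p) *\<^sub>R column 1 W"
  define B2 where "B2 = (1 / r) *\<^sub>R (column 2 W - q *\<^sub>R B1)"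
  have e1: "norm e1 = 1" using p by (simp add: e1_def p_def)
  show thesis
  proof (rule that[of e1 e2 p r q B1 B2])
    show "norm e2 = 1" using r by (simp add: e2_def r_def)
    show "e1 \<bullet> e2 = 0" using e1 by (simp add: e2_def q_def inner_diff_right norm_eq_1)
  qed (use p r e1 in \<open>simp_all add: e1_def e2_def B1_def B2_def flip: j1_def j2_def\<close>)
qed

text \<open>With J = E R, the operator J (J^T J)^-1 R^T equals E. So the coordinate formula in
  \<open>surf_grad\<close> gives the gradient with frame components \<open>y1\<close> and
  \<open>y2\<close>.\<close>

lemma pseudoinverse_frame:
  fixes J :: "real^2^3" and y1 y2 :: real
  assumes e: "norm e1 = 1" "norm e2 = 1" "e1 \<bullet> e2 = 0" and pr: "0 < p" "0 < r"
    and J: "column 1 J = p *\<^sub>R e1" "column 2 J = q *\<^sub>R e1 + r *\<^sub>R e2"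
  shows "J *v (matrix_inv (transpose J ** J) *v vector [p * y1, q * y1 + r * y2]) = y1 *\<^sub>R e1 + y2 *\<^sub>R e2"
proof -
  let ?G = "transpose J ** J"
  \<comment> \<open>R^-1 y by back substitution. Checking that \<open>?G\<close> maps it to R^T y
    avoids computing the inverse matrix.\<close>
  let ?h = "vector [(y1 - q * (y2 / r)) / p, y2 / r] :: real^2"
  have ip: "e1 \<bullet> e1 = 1" "e2 \<bullet> e2 = 1" "e2 \<bullet> e1 = 0"
    using e by (auto simp: norm_eq_1 inner_commute)
  have G: "?G $ i $ j = column i J \<bullet> column j J" for i j
    by (simp add: matrix_mult_transpose_dot_column)
  have apply_2: "(M *v h) $ i = M $ i $ 1 * h $ 1 + M $ i $ 2 * h $ 2" for M :: "real^2^2" and h i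
    by (simp add: matrix_vector_mult_def sum_2)
  have "det ?G = p\<^sup>2 * r\<^sup>2"
    unfolding det_2 G J using e ip by (simp add: inner_add_left inner_add_right power2_eq_square algebra_simps)
  then have "invertible ?G" using pr by (simp add: invertible_det_nz)
  then have inv: "matrix_inv ?G ** ?G = mat 1"
    unfolding matrix_inv_def invertible_def by (rule someI2_ex) auto
  have "?G *v ?h = vector [p * y1, q * y1 + r * y2]"
    unfolding vec_eq_iff forall_2 apply_2 G J
    using e ip pr by (simp add: inner_add_left inner_add_right field_simps)
  then have "matrix_inv ?G *v vector [p * y1, q * y1 + r * y2] = ?h"
    by (metis inv matrix_vector_mul_assoc matrix_vector_mul_lid)
  moreover have "J *v ?h = y1 *\<^sub>R e1 + y2 *\<^sub>R e2"
    using pr by (simp add: matrix_mult_sum sum_2 scalar_mult_eq_scaleR J scaleR_add_right scaleR_diff_left mult.commute)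
  ultimately show ?thesis by simp
qed

section \<open>Partial derivatives of finite element functions\<close>

lemma lag_factor_eq_poly: "\<exists>P. \<forall>s. lag_factor k a s = poly P s"
  by (rule exI[of _ "\<Prod>i<a. smult (1 / (real a - real i)) [:- real i, real k:]"])
     (simp add: lag_factor_def poly_prod mult.commute diff_divide_distrib)

text \<open>A product of three polynomials in the barycentric coordinates. Continuity is stated for
  each fixed direction, the form in which the partial derivatives use it.\<close>

lemma loc_basis_has_continuous_derivative:
  "\<exists>D. (\<forall>\<xi>. (loc_basis k \<alpha> has_derivative D \<xi>) (at \<xi>)) \<and> (\<forall>h. continuous_on UNIV (\<lambda>\<xi>. D \<xi> h))"
proof -
  obtain P Q R where PQR: "\<And>s. lag_factor k (fst \<alpha>) s = poly P s"
    "\<And>s. lag_factor k (snd \<alpha>) s = poly Q s" "\<And>s. lag_factor k (k - fst \<alpha> - snd \<alpha>) s = poly R s"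
    using lag_factor_eq_poly by metis
  have poly_comp: "((\<lambda>\<xi>. poly p (g \<xi>)) has_derivative (\<lambda>h. poly (pderiv p) (g \<xi>) * g' h)) (at \<xi>)"
    if "(g has_derivative g') (at \<xi>)" for p and g :: "real^2 \<Rightarrow> real" and g' \<xi>
    using DERIV_compose_FDERIV[OF poly_DERIV that] by (simp add: mult.commute)
  let ?z = "\<lambda>\<xi>::real^2. 1 - \<xi>$1 - \<xi>$2"
  let ?D = "\<lambda>\<xi> h. poly P (\<xi>$1) * poly Q (\<xi>$2) * (poly (pderiv R) (?z \<xi>) * (- h$1 - h$2))
      + (poly P (\<xi>$1) * (poly (pderiv Q) (\<xi>$2) * h$2) + poly (pderiv P) (\<xi>$1) * h$1 * poly Q (\<xi>$2))
        * poly R (?z \<xi>)"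
  have comp: "((\<lambda>\<xi>. \<xi>$i) has_derivative (\<lambda>h. h$i)) (at \<xi>)" for \<xi> :: "real^2" and i
    by (rule bounded_linear_imp_has_derivative) (rule bounded_linear_vec_nth)
  have "(?z has_derivative (\<lambda>h. - h$1 - h$2)) (at \<xi>)" for \<xi>
    by (auto intro!: derivative_eq_intros comp)
  then have "(loc_basis k \<alpha> has_derivative ?D \<xi>) (at \<xi>)" for \<xi>
    unfolding loc_basis_def[abs_def] PQR by (intro has_derivative_mult poly_comp comp)
  moreover have "continuous_on UNIV (\<lambda>\<xi>. ?D \<xi> h)" for h
    by (intro continuous_intros)
  ultimately show ?thesis by (intro exI[of _ ?D]) auto
qed

definition fe_partial :: "fe_mesh \<Rightarrow> (nat \<Rightarrow> 'v::real_normed_vector) \<Rightarrow> nat \<Rightarrow> 2 \<Rightarrow> real^2 \<Rightarrow> 'v" where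
  "fe_partial T w e i \<xi> = frechet_derivative (fe_fun T w e) (at \<xi>) (axis i 1)"

lemma fe_fun_differentiable: "fe_fun T w e differentiable (at \<xi>)"
  for w :: "nat \<Rightarrow> 'v::real_normed_vector"
proof -
  have "loc_basis k \<alpha> differentiable (at \<xi>)" for k \<alpha>
    using loc_basis_has_continuous_derivative[of k \<alpha>] by (auto simp: differentiable_def)
  moreover have "finite (loc_idx k)" for k
    by (rule finite_subset[of _ "SIGMA a:{..k}. {..k}"]) (auto simp: loc_idx_def)
  ultimately show ?thesis
    unfolding fe_fun_def[abs_def] by (intro differentiable_sum differentiable_scaleR differentiable_const ballI)
qed

text \<open>Only the basis functions are differentiated. This makes \<open>fe_partial\<close> linear
  in the nodal vector and reduces its continuity to that of the basis derivatives.\<close>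

lemma fe_partial_eq_sum:
  "fe_partial T w e i \<xi> = (\<Sum>\<alpha>\<in>loc_idx (mdeg T).
     frechet_derivative (loc_basis (mdeg T) \<alpha>) (at \<xi>) (axis i 1) *\<^sub>R w (gnode T e \<alpha>))"
proof -
  have "(loc_basis k \<alpha> has_derivative frechet_derivative (loc_basis k \<alpha>) (at \<xi>)) (at \<xi>)" for k \<alpha>
    using loc_basis_has_continuous_derivative[of k \<alpha>]
    by (auto simp: differentiable_def simp flip: frechet_derivative_works)
  then have "(fe_fun T w e has_derivative (\<lambda>h. \<Sum>\<alpha>\<in>loc_idx (mdeg T).
     frechet_derivative (loc_basis (mdeg T) \<alpha>) (at \<xi>) h *\<^sub>R w (gnode T e \<alpha>))) (at \<xi>)"
    unfolding fe_fun_def[abs_def] by (intro has_derivative_sum has_derivative_scaleR_left)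
  from frechet_derivative_at[OF this, symmetric] show ?thesis unfolding fe_partial_def by simp
qed

lemma continuous_fe_partial: "continuous_on UNIV (fe_partial T w e i)"
proof -
  have "continuous_on UNIV (\<lambda>\<xi>. frechet_derivative (loc_basis k \<alpha>) (at \<xi>) h)" for k \<alpha> h
  proof -
    obtain D where D: "\<And>\<xi>. (loc_basis k \<alpha> has_derivative D \<xi>) (at \<xi>)"
      "continuous_on UNIV (\<lambda>\<xi>. D \<xi> h)"
      using loc_basis_has_continuous_derivative[of k \<alpha>] by auto
    then show ?thesis by (simp add: frechet_derivative_at[OF D(1), symmetric])
  qed
  then show ?thesis
    unfolding fe_partial_eq_sum[abs_def] by (intro continuous_on_sum continuous_on_scaleR continuous_on_const)
qed

text \<open>Tangent vectors move affinely in \<open>s\<close>, so their cross product is a quadratic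
  polynomial in \<open>s\<close>.\<close>

lemma fe_partial_add_scaled:
  "fe_partial T (\<lambda>m. x m + s *\<^sub>R w m) e i \<xi> = fe_partial T x e i \<xi> + s *\<^sub>R fe_partial T w e i \<xi>"
  by (simp add: fe_partial_eq_sum scaleR_add_right sum.distrib scaleR_sum_right mult.commute)

lemma fe_partial_component:
  fixes w :: "nat \<Rightarrow> real^3"
  shows "frechet_derivative (\<lambda>\<zeta>. fe_fun T w e \<zeta> $ j) (at \<xi>) (axis i 1) = fe_partial T w e i \<xi> $ j"
proof -
  have "(fe_fun T w e has_derivative frechet_derivative (fe_fun T w e) (at \<xi>)) (at \<xi>)"
    using fe_fun_differentiable frechet_derivative_works by blast
  from frechet_derivative_at[OF bounded_linear.has_derivative[OF bounded_linear_vec_nth this], symmetric]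
  show ?thesis by (simp add: fe_partial_def)
qed

lemma column_param_jac: "column i (param_jac T x e \<xi>) = fe_partial T x e i \<xi>"
  by (simp add: param_jac_def jacobian_def matrix_def column_def fe_partial_def vec_eq_iff)

text \<open>Lagrange's identity: the Gram determinant of two vectors is the squared length of their
  cross product.\<close>

lemma sqrt_det_first_form:
  "sqrt (det (first_form T x e \<xi>)) = norm (fe_partial T x e 1 \<xi> \<times> fe_partial T x e 2 \<xi>)"
proof -
  have "det (first_form T x e \<xi>) = (norm (fe_partial T x e 1 \<xi> \<times> fe_partial T x e 2 \<xi>))\<^sup>2"
    using norm_cross_dot[of "fe_partial T x e 1 \<xi>" "fe_partial T x e 2 \<xi>"]
    by (simp add: first_form_def matrix_mult_transpose_dot_column det_2 column_param_jac
        power_mult_distrib power2_norm_eq_inner inner_commute flip: power2_eq_square)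
  then show ?thesis by simp
qed

text \<open>In the frame the gradient is the sum of the outer products of \<open>e1\<close> with
  \<open>B1\<close> and of \<open>e2\<close> with \<open>B2\<close>; orthonormality then yields its
  Frobenius norm and trace. The frame is chosen at one point, without any continuity in
  \<xi>.\<close>

lemma surf_grad_vec_frame:
  fixes w :: "nat \<Rightarrow> real^3"
  assumes inj: "inj (\<lambda>h. param_jac T x e \<xi> *v h)"
  obtains e1 e2 B1 B2 p q r where "norm e1 = 1" "norm e2 = 1" "e1 \<bullet> e2 = 0" "0 < p" "0 < r"
    "fe_partial T x e 1 \<xi> = p *\<^sub>R e1" "fe_partial T x e 2 \<xi> = q *\<^sub>R e1 + r *\<^sub>R e2"
    "fe_partial T w e 1 \<xi> = p *\<^sub>R B1" "fe_partial T w e 2 \<xi> = q *\<^sub>R B1 + r *\<^sub>R B2"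
    "(norm (surf_grad_vec T x (fe_fun T w) e \<xi>))\<^sup>2 = (norm B1)\<^sup>2 + (norm B2)\<^sup>2"
    "surf_div T x (fe_fun T w) e \<xi> = e1 \<bullet> B1 + e2 \<bullet> B2"
proof -
  obtain e1 e2 B1 B2 p q r where f: "norm e1 = 1" "norm e2 = 1" "e1 \<bullet> e2 = 0" "0 < p" "0 < r"
    and J: "column 1 (param_jac T x e \<xi>) = p *\<^sub>R e1" "column 2 (param_jac T x e \<xi>) = q *\<^sub>R e1 + r *\<^sub>R e2"
    and W: "column 1 (param_jac T w e \<xi>) = p *\<^sub>R B1" "column 2 (param_jac T w e \<xi>) = q *\<^sub>R B1 + r *\<^sub>R B2"
    by (rule immersion_frame[OF inj, of "param_jac T w e \<xi>"])
  \<comment> \<open>The right side is R^T applied to the \<open>j\<close>-th entries of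
    \<open>B1\<close> and \<open>B2\<close>, as \<open>pseudoinverse_frame\<close> expects.\<close>
  have comp: "(\<chi> i. frechet_derivative (\<lambda>\<zeta>. fe_fun T w e \<zeta> $ j) (at \<xi>) (axis i 1))
      = vector [p * B1 $ j, q * B1 $ j + r * B2 $ j]" for j
    using W by (simp add: vec_eq_iff forall_2 fe_partial_component column_param_jac)
  have grad: "surf_grad_vec T x (fe_fun T w) e \<xi> = (\<chi> i. e1 $ i *\<^sub>R B1 + e2 $ i *\<^sub>R B2)" (is "?A = _")
    unfolding surf_grad_vec_def surf_grad_def comp first_form_def pseudoinverse_frame[OF f J]
    by (simp add: vec_eq_iff mult.commute)
  have e: "(\<Sum>i\<in>UNIV. e1 $ i * e1 $ i) = 1" "(\<Sum>i\<in>UNIV. e2 $ i * e2 $ i) = 1"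
    "(\<Sum>i\<in>UNIV. e1 $ i * e2 $ i) = 0"
    using f(1-3) by (simp_all add: norm_eq_1 inner_vec_def)
  have "(norm ?A)\<^sup>2 = (\<Sum>i\<in>UNIV. ?A $ i \<bullet> ?A $ i)"
    unfolding power2_norm_eq_inner by (rule inner_vec_def)
  also have "\<dots> = (\<Sum>i\<in>UNIV. e1 $ i * e1 $ i * (B1 \<bullet> B1) + 2 * (e1 $ i * e2 $ i * (B1 \<bullet> B2))
      + e2 $ i * e2 $ i * (B2 \<bullet> B2))"
    unfolding grad by (simp add: inner_add_left inner_add_right inner_commute algebra_simps)
  also have "\<dots> = (norm B1)\<^sup>2 + (norm B2)\<^sup>2"
    unfolding sum.distrib sum_distrib_left[symmetric] sum_distrib_right[symmetric] e
    by (simp add: power2_norm_eq_inner)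
  finally have norm: "(norm ?A)\<^sup>2 = (norm B1)\<^sup>2 + (norm B2)\<^sup>2" .
  have div: "surf_div T x (fe_fun T w) e \<xi> = e1 \<bullet> B1 + e2 \<bullet> B2"
    by (simp add: surf_div_def trace_def grad inner_vec_def sum.distrib)
  show thesis
    by (rule that[of e1 e2 p r q B1 B2]) (use f J W norm div in \<open>simp_all add: column_param_jac\<close>)
qed

section \<open>The area element along the path of surfaces\<close>

text \<open>The area element \<open>sqrt (det (first_form T x e \<xi>))\<close>, in a form that is
  visibly continuous for every nodal vector.\<close>

definition area_density :: "fe_mesh \<Rightarrow> (nat \<Rightarrow> real^3) \<Rightarrow> nat \<Rightarrow> real^2 \<Rightarrow> real" where
  "area_density T x e \<xi> = norm (fe_partial T x e 1 \<xi> \<times> fe_partial T x e 2 \<xi>)"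

lemma surf_integral_eq:
  "surf_integral T x g = (\<Sum>e<nelems T. integral ref_triangle (\<lambda>\<xi>. area_density T x e \<xi> *\<^sub>R g e \<xi>))"
  by (simp add: surf_integral_def sqrt_det_first_form area_density_def)

lemma continuous_area_density: "continuous_on A (area_density T x e)"
  unfolding area_density_def[abs_def]
  by (intro continuous_on_norm continuous_on_cross continuous_on_subset[OF continuous_fe_partial] subset_UNIV)

context
  fixes T :: fe_mesh and x w :: "nat \<Rightarrow> real^3" and e :: nat and \<xi> :: "real^2"
  assumes inj: "inj (\<lambda>h. param_jac T x e \<xi> *v h)"
begin

lemma area_density_pos: "0 < area_density T x e \<xi>"
proof -
  obtain e1 e2 :: "real^3" and p q r where f: "norm e1 = 1" "norm e2 = 1" "e1 \<bullet> e2 = 0" "0 < p" "0 < r"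
    "fe_partial T x e 1 \<xi> = p *\<^sub>R e1" "fe_partial T x e 2 \<xi> = q *\<^sub>R e1 + r *\<^sub>R e2"
    by (rule surf_grad_vec_frame[OF inj, of x])
  have "norm (e1 \<times> e2) = 1" by (intro norm_cross_orthonormal f)
  then show ?thesis
    using f by (simp add: area_density_def cross_add_right cross_mult_left cross_mult_right)
qed

text \<open>The factor \<open>p\<^sup>2 * r\<^sup>2\<close> clears all denominators and leaves a
  polynomial in the partial derivatives, from which the frame has disappeared. Continuity of the
  gradient norm rests on this.\<close>

lemma area_density_norm_grad:
  "area_density T x e \<xi> * area_density T x e \<xi> * (norm (surf_grad_vec T x (fe_fun T w) e \<xi>))\<^sup>2 =
    (norm (fe_partial T w e 1 \<xi>))\<^sup>2 * (norm (fe_partial T x e 2 \<xi>))\<^sup>2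
    - 2 * (fe_partial T w e 1 \<xi> \<bullet> fe_partial T w e 2 \<xi>) * (fe_partial T x e 1 \<xi> \<bullet> fe_partial T x e 2 \<xi>)
    + (norm (fe_partial T w e 2 \<xi>))\<^sup>2 * (norm (fe_partial T x e 1 \<xi>))\<^sup>2"
proof -
  obtain e1 e2 B1 B2 p q r where f: "norm e1 = 1" "norm e2 = 1" "e1 \<bullet> e2 = 0" "0 < p" "0 < r"
    "fe_partial T x e 1 \<xi> = p *\<^sub>R e1" "fe_partial T x e 2 \<xi> = q *\<^sub>R e1 + r *\<^sub>R e2"
    "fe_partial T w e 1 \<xi> = p *\<^sub>R B1" "fe_partial T w e 2 \<xi> = q *\<^sub>R B1 + r *\<^sub>R B2"
    "(norm (surf_grad_vec T x (fe_fun T w) e \<xi>))\<^sup>2 = (norm B1)\<^sup>2 + (norm B2)\<^sup>2"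
    by (rule surf_grad_vec_frame[OF inj, of w])
  have ip: "e1 \<bullet> e1 = 1" "e2 \<bullet> e2 = 1" "e2 \<bullet> e1 = 0"
    using f by (auto simp: norm_eq_1 inner_commute)
  have "area_density T x e \<xi> * area_density T x e \<xi> = p\<^sup>2 * r\<^sup>2"
    using norm_cross_dot[of e1 e2] f
    by (simp add: area_density_def cross_add_right cross_mult_left cross_mult_right power2_eq_square)
  then show ?thesis
    using f(3) ip unfolding f(6-10) unfolding power2_norm_eq_inner
    by (simp add: inner_add_left inner_add_right inner_commute power2_eq_square algebra_simps)
qed

text \<open>The frame-free formula for the divergence: the cross product times its own first
  variation.\<close>

lemma area_density_div:
  "area_density T x e \<xi> * area_density T x e \<xi> * surf_div T x (fe_fun T w) e \<xi> =
    (fe_partial T x e 1 \<xi> \<times> fe_partial T x e 2 \<xi>) \<bullet>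
    (fe_partial T x e 1 \<xi> \<times> fe_partial T w e 2 \<xi> + fe_partial T w e 1 \<xi> \<times> fe_partial T x e 2 \<xi>)"
proof -
  obtain e1 e2 B1 B2 p q r where f: "norm e1 = 1" "norm e2 = 1" "e1 \<bullet> e2 = 0" "0 < p" "0 < r"
    "fe_partial T x e 1 \<xi> = p *\<^sub>R e1" "fe_partial T x e 2 \<xi> = q *\<^sub>R e1 + r *\<^sub>R e2"
    "fe_partial T w e 1 \<xi> = p *\<^sub>R B1" "fe_partial T w e 2 \<xi> = q *\<^sub>R B1 + r *\<^sub>R B2"
    "surf_div T x (fe_fun T w) e \<xi> = e1 \<bullet> B1 + e2 \<bullet> B2"
    by (rule surf_grad_vec_frame[OF inj, of w])
  have ip: "e1 \<bullet> e1 = 1" "e2 \<bullet> e2 = 1" "e2 \<bullet> e1 = 0"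
    using f by (auto simp: norm_eq_1 inner_commute)
  have "area_density T x e \<xi> * area_density T x e \<xi> = p\<^sup>2 * r\<^sup>2"
    using norm_cross_dot[of e1 e2] f
    by (simp add: area_density_def cross_add_right cross_mult_left cross_mult_right power2_eq_square)
  then show ?thesis
    using f(3) ip unfolding f(6-10)
    by (simp add: inner_add_left inner_add_right dot_cross inner_commute power2_eq_square algebra_simps)
qed

lemma surf_div_bound: "\<bar>surf_div T x (fe_fun T w) e \<xi>\<bar> \<le> 2 * norm (surf_grad_vec T x (fe_fun T w) e \<xi>)"
proof -
  let ?g = "norm (surf_grad_vec T x (fe_fun T w) e \<xi>)"
  obtain e1 e2 B1 B2 :: "real^3" where f: "norm e1 = 1" "norm e2 = 1"
    "?g\<^sup>2 = (norm B1)\<^sup>2 + (norm B2)\<^sup>2" "surf_div T x (fe_fun T w) e \<xi> = e1 \<bullet> B1 + e2 \<bullet> B2"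
    by (rule surf_grad_vec_frame[OF inj, of w])
  have "norm B1 \<le> ?g" "norm B2 \<le> ?g" by (rule power2_le_imp_le; simp add: f(3))+
  then show ?thesis
    unfolding f(4) using Cauchy_Schwarz_ineq2[of e1 B1] Cauchy_Schwarz_ineq2[of e2 B2] f by simp
qed

text \<open>The parallelogram estimate, multiplied by the unperturbed area element
  \<open>p * r'\<close>.\<close>

lemma area_density_expansion:
  assumes S: "S * norm (surf_grad_vec T x (fe_fun T w) e \<xi>) \<le> 1/2" and s: "\<bar>s\<bar> \<le> S" and r: "\<bar>r\<bar> \<le> S"
  shows "\<bar>area_density T (\<lambda>i. x i + s *\<^sub>R w i) e \<xi> - area_density T (\<lambda>i. x i + r *\<^sub>R w i) e \<xi>
      - (s - r) * (area_density T x e \<xi> * surf_div T x (fe_fun T w) e \<xi>)\<bar>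
    \<le> 48 * S * \<bar>s - r\<bar> * (area_density T x e \<xi> * (norm (surf_grad_vec T x (fe_fun T w) e \<xi>))\<^sup>2)"
proof -
  let ?g = "norm (surf_grad_vec T x (fe_fun T w) e \<xi>)"
  obtain e1 e2 B1 B2 p q r' where f: "norm e1 = 1" "norm e2 = 1" "e1 \<bullet> e2 = 0" "0 < p" "0 < r'"
    "fe_partial T x e 1 \<xi> = p *\<^sub>R e1" "fe_partial T x e 2 \<xi> = q *\<^sub>R e1 + r' *\<^sub>R e2"
    "fe_partial T w e 1 \<xi> = p *\<^sub>R B1" "fe_partial T w e 2 \<xi> = q *\<^sub>R B1 + r' *\<^sub>R B2"
    "?g\<^sup>2 = (norm B1)\<^sup>2 + (norm B2)\<^sup>2" "surf_div T x (fe_fun T w) e \<xi> = e1 \<bullet> B1 + e2 \<bullet> B2"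
    by (rule surf_grad_vec_frame[OF inj, of w])
  let ?n = "\<lambda>t. norm ((e1 + t *\<^sub>R B1) \<times> (e2 + t *\<^sub>R B2))"
  \<comment> \<open>The \<open>q\<close> term vanishes with X \<times> X = 0, so passing to the
    frame costs the same factor for every parameter.\<close>
  have cross_triangular: "(p *\<^sub>R X) \<times> (q *\<^sub>R X + r' *\<^sub>R Y) = (p * r') *\<^sub>R (X \<times> Y)" for X Y :: "real^3"
    by (simp add: cross_add_right cross_mult_left cross_mult_right)
  have dens: "area_density T (\<lambda>i. x i + t *\<^sub>R w i) e \<xi> = p * r' * ?n t" for t
  proof -
    have "fe_partial T (\<lambda>i. x i + t *\<^sub>R w i) e 1 \<xi> \<times> fe_partial T (\<lambda>i. x i + t *\<^sub>R w i) e 2 \<xi>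
        = (p *\<^sub>R (e1 + t *\<^sub>R B1)) \<times> (q *\<^sub>R (e1 + t *\<^sub>R B1) + r' *\<^sub>R (e2 + t *\<^sub>R B2))"
      unfolding fe_partial_add_scaled f(6-9) by (simp add: algebra_simps)
    also have "\<dots> = (p * r') *\<^sub>R ((e1 + t *\<^sub>R B1) \<times> (e2 + t *\<^sub>R B2))"
      by (rule cross_triangular)
    finally show ?thesis using f by (simp add: area_density_def)
  qed
  have dens0: "area_density T x e \<xi> = p * r'" using dens[of 0] f by (simp add: norm_cross_orthonormal)
  have "\<bar>p * r' * ?n s - p * r' * ?n r - (s - r) * (p * r' * (e1 \<bullet> B1 + e2 \<bullet> B2))\<bar>
      = \<bar>p * r' * (?n s - ?n r - (e1 \<bullet> B1 + e2 \<bullet> B2) * (s - r))\<bar>"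
    by (simp add: algebra_simps)
  also have "\<dots> = p * r' * \<bar>?n s - ?n r - (e1 \<bullet> B1 + e2 \<bullet> B2) * (s - r)\<bar>"
    using f by (simp add: abs_mult)
  also have "\<dots> \<le> p * r' * (48 * S * ?g\<^sup>2 * \<bar>s - r\<bar>)"
    by (intro mult_left_mono parallelogram_area_expansion f S s r) (use f in auto)
  finally show ?thesis
    unfolding dens dens0 f(11) by (simp add: mult_ac)
qed

end

section \<open>Expansion of the area\<close>

lemma compact_ref_triangle: "compact ref_triangle"
proof -
  have "closed ref_triangle"
    unfolding ref_triangle_def by (intro closed_Collect_conj closed_Collect_le continuous_intros)
  moreover have "ref_triangle \<subseteq> cbox (vector [0, 0]) (vector [1, 1])"
    by (auto simp: ref_triangle_def mem_box_cart forall_2)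
  ultimately show ?thesis
    by (meson bounded_cbox bounded_subset compact_eq_bounded_closed)
qed

lemma closure_interior_ref_triangle: "closure (interior ref_triangle) = ref_triangle"
proof -
  have "convex ref_triangle"
  proof (rule convexI)
    fix \<xi> \<zeta> :: "real^2" and a b :: real
    assume *: "\<xi> \<in> ref_triangle" "\<zeta> \<in> ref_triangle" "0 \<le> a" "0 \<le> b" "a + b = 1"
    then have "a * (\<xi>$1 + \<xi>$2) + b * (\<zeta>$1 + \<zeta>$2) \<le> a * 1 + b * 1"
      by (intro add_mono mult_left_mono) (auto simp: ref_triangle_def)
    then show "a *\<^sub>R \<xi> + b *\<^sub>R \<zeta> \<in> ref_triangle"
      using * by (simp add: ref_triangle_def algebra_simps)
  qed
  moreover have "open {\<xi>::real^2. 0 < \<xi>$1 \<and> 0 < \<xi>$2 \<and> \<xi>$1 + \<xi>$2 < 1}"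
    by (intro open_Collect_conj open_Collect_less continuous_intros)
  then have "{\<xi>::real^2. 0 < \<xi>$1 \<and> 0 < \<xi>$2 \<and> \<xi>$1 + \<xi>$2 < 1} \<subseteq> interior ref_triangle"
    by (intro interior_maximal) (auto simp: ref_triangle_def)
  then have "(vector [1/4, 1/4] :: real^2) \<in> interior ref_triangle" by auto
  ultimately have "closure (interior ref_triangle) = closure ref_triangle"
    by (intro convex_closure_interior) auto
  then show ?thesis using compact_imp_closed[OF compact_ref_triangle] by simp
qed

text \<open>The part of the interior where \<open>f\<close> exceeds \<open>C\<close> is open and
  negligible, hence empty; continuity carries the bound to the boundary.\<close>

lemma AE_ref_triangle_imp_le:
  fixes f :: "real^2 \<Rightarrow> real"
  assumes f: "continuous_on ref_triangle f"
    and AE: "AE \<xi> in lborel. \<xi> \<in> ref_triangle \<longrightarrow> f \<xi> \<le> C" and \<xi>: "\<xi> \<in> ref_triangle"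
  shows "f \<xi> \<le> C"
proof -
  obtain N where N: "{\<xi> \<in> space lborel. \<not> (\<xi> \<in> ref_triangle \<longrightarrow> f \<xi> \<le> C)} \<subseteq> N"
    "emeasure lborel N = 0" "N \<in> sets lborel"
    using AE by (rule AE_E)
  define U where "U = interior ref_triangle \<inter> f -` {C<..}"
  have "open U"
    unfolding U_def
    by (intro continuous_open_preimage continuous_on_subset[OF f] interior_subset open_interior) auto
  moreover have "U \<subseteq> N" using N(1) interior_subset[of ref_triangle] by (auto simp: U_def)
  moreover have "negligible N"
    using N(2,3) by (simp add: negligible_iff_null_sets null_sets_completionI null_setsI)
  ultimately have "U = {}" by (meson negligible_subset open_not_negligible)
  then have le: "f \<zeta> \<le> C" if "\<zeta> \<in> interior ref_triangle" for \<zeta>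
    using that by (force simp: U_def)
  show ?thesis
    by (rule continuous_le_on_closure[of "interior ref_triangle" f \<xi> C])
       (use f \<xi> le in \<open>simp_all add: closure_interior_ref_triangle\<close>)
qed

section \<open>Integration over the surface and first variation of the area\<close>

context
  fixes T :: fe_mesh and x w :: "nat \<Rightarrow> real^3"
  assumes reg: "regular_surface T x"
begin

private abbreviation (input) G where "G \<equiv> surf_grad_vec T x (fe_fun T w)"
private abbreviation (input) dv where "dv \<equiv> surf_div T x (fe_fun T w)"

private lemma inj_param_jac: "inj (\<lambda>h. param_jac T x e \<xi> *v h)" if "e < nelems T" "\<xi> \<in> ref_triangle" for e \<xi>
  using reg that by (auto simp: regular_surface_def)

private lemma continuous_partial: "continuous_on ref_triangle (fe_partial T y e i)" for y :: "nat \<Rightarrow> real^3"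
  by (rule continuous_on_subset[OF continuous_fe_partial]) simp

text \<open>Pointwise frames say nothing about continuity, so the frame-free formula is divided by
  the positive squared area element.\<close>

lemma continuous_norm_surf_grad:
  assumes e: "e < nelems T"
  shows "continuous_on ref_triangle (\<lambda>\<xi>. norm (G e \<xi>))"
proof -
  let ?J = "area_density T x e"
  have "continuous_on ref_triangle (\<lambda>\<xi>. sqrt (((norm (fe_partial T w e 1 \<xi>))\<^sup>2 * (norm (fe_partial T x e 2 \<xi>))\<^sup>2
    - 2 * (fe_partial T w e 1 \<xi> \<bullet> fe_partial T w e 2 \<xi>) * (fe_partial T x e 1 \<xi> \<bullet> fe_partial T x e 2 \<xi>)
    + (norm (fe_partial T w e 2 \<xi>))\<^sup>2 * (norm (fe_partial T x e 1 \<xi>))\<^sup>2) / (?J \<xi> * ?J \<xi>)))" (is "continuous_on _ ?f")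
    by (intro continuous_intros continuous_partial continuous_area_density)
       (use area_density_pos[OF inj_param_jac[OF e]] in force)
  moreover have "norm (G e \<xi>) = ?f \<xi>" if \<xi>: "\<xi> \<in> ref_triangle" for \<xi>
    using area_density_pos[OF inj_param_jac[OF e \<xi>]]
    unfolding area_density_norm_grad[OF inj_param_jac[OF e \<xi>], symmetric] by simp
  ultimately show ?thesis by (simp cong: continuous_on_cong)
qed

lemma continuous_surf_div:
  assumes e: "e < nelems T"
  shows "continuous_on ref_triangle (dv e)"
proof -
  let ?J = "area_density T x e"
  have "continuous_on ref_triangle (\<lambda>\<xi>. ((cross3 (fe_partial T x e 1 \<xi>) (fe_partial T x e 2 \<xi>)) \<bullet>
    (cross3 (fe_partial T x e 1 \<xi>) (fe_partial T w e 2 \<xi>) + cross3 (fe_partial T w e 1 \<xi>) (fe_partial T x e 2 \<xi>)))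
      / (?J \<xi> * ?J \<xi>))" (is "continuous_on _ ?f")
    by (intro continuous_intros continuous_on_cross continuous_partial continuous_area_density)
       (use area_density_pos[OF inj_param_jac[OF e]] in force)
  moreover have "dv e \<xi> = ?f \<xi>" if \<xi>: "\<xi> \<in> ref_triangle" for \<xi>
    using area_density_pos[OF inj_param_jac[OF e \<xi>]]
    unfolding area_density_div[OF inj_param_jac[OF e \<xi>], symmetric] by simp
  ultimately show ?thesis by (simp cong: continuous_on_cong)
qed

lemma norm_surf_grad_le_Linf:
  assumes e: "e < nelems T" and \<xi>: "\<xi> \<in> ref_triangle"
  shows "norm (G e \<xi>) \<le> Linf_norm_surf T G"
  unfolding Linf_norm_surf_def
proof (rule cInf_greatest)
  \<comment> \<open>An infimum is bounded below by \<open>cInf_greatest\<close> only over a nonempty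
    set; compactness and finitely many elements supply an admissible constant.\<close>
  have "bounded (\<Union>e<nelems T. (\<lambda>\<xi>. norm (G e \<xi>)) ` ref_triangle)"
    by (intro bounded_UN ballI compact_imp_bounded compact_continuous_image
        continuous_norm_surf_grad compact_ref_triangle) auto
  then obtain C where "C > 0" "\<forall>e<nelems T. \<forall>\<xi>\<in>ref_triangle. norm (G e \<xi>) \<le> C"
    by (auto simp: bounded_pos)
  then show "{C. 0 \<le> C \<and> (\<forall>e<nelems T. AE \<xi> in lborel. \<xi> \<in> ref_triangle \<longrightarrow> norm (G e \<xi>) \<le> C)} \<noteq> {}"
    by (auto intro!: exI[of _ C])
next
  fix C assume "C \<in> {C. 0 \<le> C \<and> (\<forall>e<nelems T. AE \<xi> in lborel. \<xi> \<in> ref_triangle \<longrightarrow> norm (G e \<xi>) \<le> C)}"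
  then show "norm (G e \<xi>) \<le> C"
    using AE_ref_triangle_imp_le[OF continuous_norm_surf_grad[OF e] _ \<xi>] e by auto
qed

private lemma integrable_ref_triangle: "continuous_on ref_triangle g \<Longrightarrow> g integrable_on ref_triangle"
  for g :: "real^2 \<Rightarrow> real"
  using borel_integrable_compact[OF compact_ref_triangle, of g] set_borel_integral_eq_integral(1)
  unfolding set_integrable_def by blast

lemma L2_norm_surf_grad_squared:
  "(L2_norm_surf T x G)\<^sup>2 = (\<Sum>e<nelems T. integral ref_triangle (\<lambda>\<xi>. area_density T x e \<xi> * (norm (G e \<xi>))\<^sup>2))"
proof -
  have "0 \<le> (\<Sum>e<nelems T. integral ref_triangle (\<lambda>\<xi>. area_density T x e \<xi> * (norm (G e \<xi>))\<^sup>2))"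
    by (intro sum_nonneg integral_nonneg integrable_ref_triangle continuous_intros continuous_area_density
        continuous_norm_surf_grad) (auto simp: area_density_def)
  then show ?thesis by (simp add: L2_norm_surf_def surf_integral_eq)
qed

text \<open>The pointwise expansion is integrated over each element. The hypothesis on the essential
  supremum holds at every point by continuity, which is what the pointwise estimate
  requires.\<close>

lemma area_expansion:
  assumes S: "S * Linf_norm_surf T G \<le> 1/2" and s: "\<bar>s\<bar> \<le> S" and r: "\<bar>r\<bar> \<le> S"
  shows "\<bar>area T (\<lambda>i. x i + s *\<^sub>R w i) - area T (\<lambda>i. x i + r *\<^sub>R w i) - (s - r) * surf_integral T x dv\<bar>
    \<le> 48 * S * \<bar>s - r\<bar> * (L2_norm_surf T x G)\<^sup>2"
proof -
  let ?J = "\<lambda>s e \<xi>. area_density T (\<lambda>i. x i + s *\<^sub>R w i) e \<xi>" and ?D = "area_density T x"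
  let ?R = "\<lambda>e \<xi>. ?J s e \<xi> - ?J r e \<xi> - (s - r) * (?D e \<xi> * dv e \<xi>)"
  let ?B = "\<lambda>e \<xi>. 48 * S * \<bar>s - r\<bar> * (?D e \<xi> * (norm (G e \<xi>))\<^sup>2)"
  have int: "(\<lambda>\<xi>. ?D e \<xi> * dv e \<xi>) integrable_on ref_triangle"
    "(\<lambda>\<xi>. ?D e \<xi> * (norm (G e \<xi>))\<^sup>2) integrable_on ref_triangle"
    if "e < nelems T" for e
    by (intro integrable_ref_triangle continuous_intros continuous_area_density continuous_surf_div
        continuous_norm_surf_grad that)+
  have intJ: "?J t e integrable_on ref_triangle" for t e
    by (intro integrable_ref_triangle continuous_area_density)
  have R: "\<bar>integral ref_triangle (?R e)\<bar> \<le> integral ref_triangle (?B e)" if e: "e < nelems T" for e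
  proof -
    have "norm (?R e \<xi>) \<le> ?B e \<xi>" if \<xi>: "\<xi> \<in> ref_triangle" for \<xi>
    proof -
      have "S * norm (G e \<xi>) \<le> S * Linf_norm_surf T G"
        using norm_surf_grad_le_Linf[OF e \<xi>] s by (intro mult_left_mono) auto
      then show ?thesis
        using area_density_expansion[OF inj_param_jac[OF e \<xi>], of S w s r] S s r by simp
    qed
    then have "norm (integral ref_triangle (?R e)) \<le> integral ref_triangle (?B e)"
      by (intro integral_norm_bound_integral integrable_diff integrable_on_mult_right int intJ e)
    then show ?thesis by simp
  qed
  have "area T (\<lambda>i. x i + s *\<^sub>R w i) - area T (\<lambda>i. x i + r *\<^sub>R w i) - (s - r) * surf_integral T x dv
      = (\<Sum>e<nelems T. integral ref_triangle (?J s e) - integral ref_triangle (?J r e)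
          - (s - r) * integral ref_triangle (\<lambda>\<xi>. ?D e \<xi> * dv e \<xi>))"
    by (simp add: area_def surf_integral_eq sum_subtractf sum_distrib_left)
  also have "\<dots> = (\<Sum>e<nelems T. integral ref_triangle (?R e))"
    by (intro sum.cong refl)
       (simp add: integral_diff integrable_diff integrable_on_mult_right int intJ)
  also have "\<bar>\<dots>\<bar> \<le> (\<Sum>e<nelems T. integral ref_triangle (?B e))"
    by (intro order_trans[OF sum_abs] sum_mono) (use R in auto)
  also have "\<dots> = 48 * S * \<bar>s - r\<bar> * (L2_norm_surf T x G)\<^sup>2"
    unfolding L2_norm_surf_grad_squared sum_distrib_left by simp
  finally show ?thesis .
qed

text \<open>Young's inequality 2 g \<le> \<epsilon> + g^2 / \<epsilon>, applied pointwise to the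
  bound |div| \<le> 2 g, takes the place of Cauchy-Schwarz for integrals.\<close>

lemma surf_integral_div_bound:
  assumes \<epsilon>: "0 < \<epsilon>"
  shows "\<bar>surf_integral T x dv\<bar> \<le> \<epsilon> * area T x + (L2_norm_surf T x G)\<^sup>2 / \<epsilon>"
proof -
  let ?J = "area_density T x"
  have int: "(\<lambda>\<xi>. ?J e \<xi> * dv e \<xi>) integrable_on ref_triangle"
    "(\<lambda>\<xi>. ?J e \<xi> * (norm (G e \<xi>))\<^sup>2) integrable_on ref_triangle" "?J e integrable_on ref_triangle"
    if "e < nelems T" for e
    by (intro integrable_ref_triangle continuous_intros continuous_area_density continuous_surf_div
        continuous_norm_surf_grad that)+
  have "\<bar>integral ref_triangle (\<lambda>\<xi>. ?J e \<xi> * dv e \<xi>)\<bar>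
      \<le> \<epsilon> * integral ref_triangle (?J e) + integral ref_triangle (\<lambda>\<xi>. ?J e \<xi> * (norm (G e \<xi>))\<^sup>2) / \<epsilon>"
    if e: "e < nelems T" for e
  proof -
    have "norm (?J e \<xi> * dv e \<xi>) \<le> \<epsilon> * ?J e \<xi> + (?J e \<xi> * (norm (G e \<xi>))\<^sup>2) / \<epsilon>"
      if \<xi>: "\<xi> \<in> ref_triangle" for \<xi>
    proof -
      let ?g = "norm (G e \<xi>)"
      have "2 * ?g * \<epsilon> \<le> \<epsilon> * \<epsilon> + ?g\<^sup>2"
        using sum_squares_bound[of ?g \<epsilon>] by (simp add: power2_eq_square)
      then have "2 * ?g \<le> \<epsilon> + ?g\<^sup>2 / \<epsilon>" using \<epsilon> by (simp add: field_simps)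
      then have "\<bar>dv e \<xi>\<bar> \<le> \<epsilon> + ?g\<^sup>2 / \<epsilon>" using surf_div_bound[OF inj_param_jac[OF e \<xi>], of w] by linarith
      from mult_left_mono[OF this, of "?J e \<xi>"] area_density_pos[OF inj_param_jac[OF e \<xi>]]
      show ?thesis by (simp add: abs_mult algebra_simps)
    qed
    then have "norm (integral ref_triangle (\<lambda>\<xi>. ?J e \<xi> * dv e \<xi>))
        \<le> integral ref_triangle (\<lambda>\<xi>. \<epsilon> * ?J e \<xi> + (?J e \<xi> * (norm (G e \<xi>))\<^sup>2) / \<epsilon>)"
      by (intro integral_norm_bound_integral integrable_add integrable_on_mult_right
          integrable_on_divide int e)
    also have "\<dots> = \<epsilon> * integral ref_triangle (?J e) + integral ref_triangle (\<lambda>\<xi>. ?J e \<xi> * (norm (G e \<xi>))\<^sup>2) / \<epsilon>"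
      by (simp add: integral_add integrable_on_mult_right integrable_on_divide int e)
    finally show ?thesis by simp
  qed
  then have "\<bar>\<Sum>e<nelems T. integral ref_triangle (\<lambda>\<xi>. ?J e \<xi> * dv e \<xi>)\<bar>
      \<le> (\<Sum>e<nelems T. \<epsilon> * integral ref_triangle (?J e)
          + integral ref_triangle (\<lambda>\<xi>. ?J e \<xi> * (norm (G e \<xi>))\<^sup>2) / \<epsilon>)"
    by (intro order_trans[OF sum_abs] sum_mono) auto
  then show ?thesis
    by (simp add: area_def surf_integral_eq L2_norm_surf_grad_squared sum.distrib sum_distrib_left sum_divide_distrib)
qed

lemma L2_norm_surf_grad_nonzero:
  assumes "surf_integral T x dv \<noteq> 0"
  shows "L2_norm_surf T x G \<noteq> 0"
proof
  assume L: "L2_norm_surf T x G = 0"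
  let ?d = "\<bar>surf_integral T x dv\<bar>"
  \<comment> \<open>Small enough that the area term is at most half of \<open>?d\<close>; the
    summand 1 keeps the denominator positive.\<close>
  define \<epsilon> where "\<epsilon> = ?d / (2 * (\<bar>area T x\<bar> + 1))"
  have \<epsilon>: "0 < \<epsilon>" using assms by (simp add: \<epsilon>_def add_nonneg_pos)
  have "?d \<le> \<epsilon> * area T x" using surf_integral_div_bound[OF \<epsilon>] L by simp
  also have "\<dots> \<le> \<epsilon> * (\<bar>area T x\<bar> + 1)" using \<epsilon> by (intro mult_left_mono) auto
  also have "\<dots> = ?d / 2" by (simp add: \<epsilon>_def field_simps)
  finally show False using assms by simp
qed

text \<open>First variation of area: \<open>area_expansion\<close> between \<open>h\<close> and 0
  with \<open>S = \<bar>h\<bar>\<close> bounds the error of the difference quotient by a multiple of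
  |h|.\<close>

lemma area_has_derivative:
  "((\<lambda>s. area T (\<lambda>i. x i + s *\<^sub>R w i)) has_real_derivative surf_integral T x dv) (at 0)"
proof -
  let ?A = "\<lambda>s. area T (\<lambda>i. x i + s *\<^sub>R w i)" and ?L = "\<bar>Linf_norm_surf T G\<bar>"
  have ev: "\<forall>\<^sub>F h in at 0. norm ((?A (0 + h) - ?A 0) / h - surf_integral T x dv) \<le> 48 * \<bar>h\<bar> * (L2_norm_surf T x G)\<^sup>2"
    unfolding eventually_at
  \<comment> \<open>This radius ensures that |h| times the essential supremum is at most
    1/2.\<close>
  proof (intro exI[of _ "1 / (2 * (?L + 1))"] conjI ballI impI)
    fix h :: real assume h: "h \<noteq> 0 \<and> dist h 0 < 1 / (2 * (?L + 1))"
    then have "\<bar>h\<bar> * (?L + 1) < 1/2" by (simp add: pos_less_divide_eq add_nonneg_pos mult_ac)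
    moreover have "\<bar>h\<bar> * Linf_norm_surf T G \<le> \<bar>h\<bar> * (?L + 1)" by (intro mult_left_mono) auto
    ultimately have "\<bar>?A h - ?A 0 - (h - 0) * surf_integral T x dv\<bar>
        \<le> 48 * \<bar>h\<bar> * \<bar>h - 0\<bar> * (L2_norm_surf T x G)\<^sup>2"
      by (intro area_expansion) auto
    moreover have "(?A (0 + h) - ?A 0) / h - surf_integral T x dv = (?A h - ?A 0 - (h - 0) * surf_integral T x dv) / h"
      using h by (simp add: field_simps)
    ultimately show "norm ((?A (0 + h) - ?A 0) / h - surf_integral T x dv) \<le> 48 * \<bar>h\<bar> * (L2_norm_surf T x G)\<^sup>2"
      using h by (simp add: pos_divide_le_eq mult_ac)
  qed (simp add: add_nonneg_pos)
  have "((\<lambda>h. 48 * \<bar>h\<bar> * (L2_norm_surf T x G)\<^sup>2) \<longlongrightarrow> 0) (at 0)"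
    by (auto intro!: tendsto_eq_intros)
  from Lim_null_comparison[OF ev this] show ?thesis
    unfolding DERIV_def by (rule LIM_zero_cancel)
qed

end

section \<open>The multiplier equation\<close>

text \<open>Zeros of \<open>f\<close> are the fixed points of the Newton map \<open>\<phi>\<close>.
  Dividing \<open>lip\<close> by \<sigma> makes \<open>\<phi>\<close> a contraction with factor
  \<gamma>, and Banach's theorem applies on the ball of radius \<rho>.\<close>

lemma simplified_newton_converges:
  fixes f :: "real \<Rightarrow> real"
  assumes d: "deriv f 0 = d" "\<bar>d\<bar> = \<sigma>" "0 < \<sigma>"
    and \<gamma>: "0 \<le> \<gamma>" "\<gamma> < 1" and \<rho>: "\<rho> = \<bar>f 0\<bar> / (\<sigma> * (1 - \<gamma>))"
    and lip: "\<And>s r. \<bar>s\<bar> \<le> \<rho> \<Longrightarrow> \<bar>r\<bar> \<le> \<rho> \<Longrightarrow> \<bar>f s - f r - d * (s - r)\<bar> \<le> \<gamma> * \<sigma> * \<bar>s - r\<bar>"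
  shows "\<exists>l. \<bar>l\<bar> \<le> \<rho> \<and> f l = 0 \<and> (\<forall>l'. \<bar>l'\<bar> \<le> \<rho> \<and> f l' = 0 \<longrightarrow> l' = l) \<and>
    simplified_newton f \<longlonglongrightarrow> l \<and>
    (\<forall>j. \<bar>simplified_newton f (Suc j) - l\<bar> \<le> \<gamma> * \<bar>simplified_newton f j - l\<bar>)"
proof -
  define \<phi> where "\<phi> s = s - f s / d" for s
  have \<rho>0: "0 \<le> \<rho>" using d \<gamma> \<rho> by simp
  have d0: "d \<noteq> 0" using d by auto
  have con: "\<bar>\<phi> s - \<phi> r\<bar> \<le> \<gamma> * \<bar>s - r\<bar>" if "\<bar>s\<bar> \<le> \<rho>" "\<bar>r\<bar> \<le> \<rho>" for s r
  proof -
    have "\<phi> s - \<phi> r = - (f s - f r - d * (s - r)) / d"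
      using d0 by (simp add: \<phi>_def field_simps)
    then have "\<bar>\<phi> s - \<phi> r\<bar> * \<sigma> = \<bar>f s - f r - d * (s - r)\<bar>"
      using d by (simp add: abs_divide)
    then have "\<bar>\<phi> s - \<phi> r\<bar> * \<sigma> \<le> (\<gamma> * \<bar>s - r\<bar>) * \<sigma>"
      using lip[OF that] by (simp add: mult_ac)
    then show ?thesis using d by simp
  qed
  \<comment> \<open>The radius \<rho> is chosen for this equality: the first step has length \<rho>
    (1 - \<gamma>), and the contraction adds at most \<gamma> \<rho>, so the ball is mapped into
    itself.\<close>
  have \<phi>0: "\<bar>\<phi> 0\<bar> = \<rho> * (1 - \<gamma>)"
    using d \<gamma> by (simp add: \<phi>_def \<rho> abs_divide)
  have self: "\<bar>\<phi> s\<bar> \<le> \<rho>" if "\<bar>s\<bar> \<le> \<rho>" for s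
  proof -
    have "\<bar>\<phi> s\<bar> \<le> \<bar>\<phi> 0\<bar> + \<gamma> * \<bar>s\<bar>" using con[OF that, of 0] \<rho>0 by simp
    also have "\<dots> \<le> \<rho> * (1 - \<gamma>) + \<gamma> * \<rho>"
      unfolding \<phi>0 using that \<gamma> by (intro add_left_mono mult_left_mono) auto
    finally show ?thesis by (simp add: algebra_simps)
  qed
  have "\<exists>!x. x \<in> cball 0 \<rho> \<and> \<phi> x = x"
  proof (rule Banach_fix)
    show "\<phi> ` cball 0 \<rho> \<subseteq> cball 0 \<rho>" using self by (auto simp: dist_real_def)
    show "dist (\<phi> s) (\<phi> r) \<le> \<gamma> * dist s r" if "s \<in> cball 0 \<rho>" "r \<in> cball 0 \<rho>" for s r
      using that con by (simp add: dist_real_def)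
  qed (use \<gamma> \<rho>0 in \<open>simp_all add: complete_eq_closed\<close>)
  then obtain l where l: "\<bar>l\<bar> \<le> \<rho>" "\<phi> l = l" and uniq: "\<And>l'. \<bar>l'\<bar> \<le> \<rho> \<Longrightarrow> \<phi> l' = l' \<Longrightarrow> l' = l"
    by (metis mem_cball_0 real_norm_def)
  have fix_iff: "\<phi> s = s \<longleftrightarrow> f s = 0" for s using d0 by (simp add: \<phi>_def)
  have newton_Suc: "simplified_newton f (Suc j) = \<phi> (simplified_newton f j)" for j
    by (simp add: \<phi>_def d)
  have bounded: "\<bar>simplified_newton f j\<bar> \<le> \<rho>" for j
    by (induction j) (use \<rho>0 self newton_Suc in \<open>simp_all del: simplified_newton.simps(2)\<close>)
  have step: "\<bar>simplified_newton f (Suc j) - l\<bar> \<le> \<gamma> * \<bar>simplified_newton f j - l\<bar>" for j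
    using con[OF bounded l(1), of j] unfolding newton_Suc l(2) .
  have bound: "norm (simplified_newton f j - l) \<le> \<gamma> ^ j * \<bar>l\<bar>" for j
  proof (induction j)
    case (Suc j)
    have "\<gamma> * \<bar>simplified_newton f j - l\<bar> \<le> \<gamma> * (\<gamma> ^ j * \<bar>l\<bar>)"
      using Suc.IH \<gamma> by (intro mult_left_mono) simp_all
    then show ?case using step[of j] by (simp add: mult_ac)
  qed simp
  have "(\<lambda>j. \<gamma> ^ j * \<bar>l\<bar>) \<longlonglongrightarrow> 0"
    using \<gamma> by (intro tendsto_mult_left_zero LIMSEQ_realpow_zero) auto
  with always_eventually[OF allI[OF bound]] have "(\<lambda>j. simplified_newton f j - l) \<longlonglongrightarrow> 0"
    by (rule Lim_null_comparison)
  then have "simplified_newton f \<longlonglongrightarrow> l" by (rule LIM_zero_cancel)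
  then show ?thesis using l uniq step fix_iff by blast
qed

section \<open>Reduction of the step to a scalar equation\<close>

lemma dissipation_nonneg: "0 \<le> dissipation T \<tau> q x u n"
proof -
  let ?I = "{tgrid \<tau> (n - 1)..tgrid \<tau> n}"
  show ?thesis
  \<comment> \<open>A square has a nonnegative integral, and \<open>integral\<close> is 0 by
    convention for a function that is not integrable.\<close>
  proof (cases "(\<lambda>t. (p_interp T \<tau> q x u n t)\<^sup>2) integrable_on ?I")
    case True
    then show ?thesis unfolding dissipation_def by (rule integral_nonneg) simp
  qed (simp add: dissipation_def not_integrable_integral)
qed

text \<open>Elements refer only to node numbers below \<open>nnodes T\<close>, so values of the
  nodal function elsewhere cannot influence the area.\<close>

lemma area_cong_nodes:
  assumes T: "closed_triangulation T" and eq: "\<And>i. i < nnodes T \<Longrightarrow> X i = Y i"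
  shows "area T X = area T Y"
proof -
  have "gnode T e \<alpha> < nnodes T" if "e < nelems T" "\<alpha> \<in> loc_idx (mdeg T)" for e \<alpha>
    using T that by (auto simp: closed_triangulation_def elem_nodes_def)
  then have "fe_fun T X e = fe_fun T Y e" if "e < nelems T" for e
    using that eq by (auto simp: fe_fun_def intro!: ext sum.cong)
  then show ?thesis
    by (auto simp: area_def surf_integral_def first_form_def param_jac_def intro!: sum.cong)
qed

text \<open>Since the new nodes are old nodes plus \<tau> (1 + l) \<open>vbar\<close>, they equal
  \<open>xbar\<close> plus \<tau> l \<open>vbar\<close>. This eliminates \<open>X\<close> and leaves
  one scalar equation for \<open>l\<close>.\<close>

lemma position_equations_iff:
  fixes v x :: "nat \<Rightarrow> nat \<Rightarrow> real^3" and q n :: nat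
  assumes T: "closed_triangulation T" and \<tau>: "0 < \<tau>"
  defines "vbar \<equiv> time_average \<tau> q v n"
  defines "xbar \<equiv> \<lambda>i. x (n - 1) i + \<tau> *\<^sub>R vbar i"
  shows "position_equations T \<tau> q x u v n l X \<longleftrightarrow>
    (\<forall>i<nnodes T. X i = xbar i + (\<tau> * l) *\<^sub>R vbar i) \<and>
    area T (\<lambda>i. xbar i + (\<tau> * l) *\<^sub>R vbar i) - area T (x (n - 1)) = - dissipation T \<tau> q x u n"
proof -
  have node: "(1 / \<tau>) *\<^sub>R (X i - x (n - 1) i) = (1 + l) *\<^sub>R vbar i \<longleftrightarrow> X i = xbar i + (\<tau> * l) *\<^sub>R vbar i" for i
  proof -
    have "(1 / \<tau>) *\<^sub>R (X i - x (n - 1) i) = (1 + l) *\<^sub>R vbar i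
        \<longleftrightarrow> X i - x (n - 1) i = \<tau> *\<^sub>R ((1 + l) *\<^sub>R vbar i)"
      using \<tau> by (auto simp: vec_eq_iff field_simps)
    also have "\<dots> \<longleftrightarrow> X i = xbar i + (\<tau> * l) *\<^sub>R vbar i"
      by (auto simp: xbar_def algebra_simps)
    finally show ?thesis .
  qed
  show ?thesis
    unfolding position_equations_def vbar_def[symmetric] node
    using area_cong_nodes[OF T, of X "\<lambda>i. xbar i + (\<tau> * l) *\<^sub>R vbar i"] by auto
qed

lemma ex_quadratic_root:
  assumes "0 \<le> (t::real)" "t \<le> 1/4"
  shows "\<exists>\<gamma>. 0 \<le> \<gamma> \<and> \<gamma> \<le> 1/2 \<and> t = \<gamma> * (1 - \<gamma>)"
proof (intro exI conjI)
  \<comment> \<open>The smaller of the two roots, which lies in [0, 1/2].\<close>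
  let ?\<gamma> = "(1 - sqrt (1 - 4 * t)) / 2"
  show "0 \<le> ?\<gamma>" "?\<gamma> \<le> 1/2" using assms by simp_all
  have "(sqrt (1 - 4 * t))\<^sup>2 = 1 - 4 * t" using assms by simp
  then show "t = ?\<gamma> * (1 - ?\<gamma>)" by (simp add: field_simps power2_eq_square)
qed

section \<open>Existence, uniqueness and computation of the multiplier\<close>

lemma multiplier_exists_unique:
  fixes T :: fe_mesh and \<tau> :: real and x v and u :: "nat \<Rightarrow> nat \<Rightarrow> (real^3) \<times> real"
  fixes vbar xbar :: "nat \<Rightarrow> real^3" and gradv f and \<delta> \<sigma> \<gamma> \<rho> :: real
  assumes T: "closed_triangulation T" and \<tau>: "0 < \<tau>"
    and vbar: "vbar = time_average \<tau> q v n"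
    and xbar: "xbar = (\<lambda>i. x (n - 1) i + \<tau> *\<^sub>R vbar i)"
    and reg: "regular_surface T xbar"
    and gradv: "gradv = surf_grad_vec T xbar (fe_fun T vbar)"
    and \<delta>: "\<delta> = \<bar>(1 / \<tau>) * (area T xbar - area T (x (n - 1))) + (1 / \<tau>) * dissipation T \<tau> q x u n\<bar>"
    and \<sigma>: "\<sigma> = \<bar>surf_integral T xbar (surf_div T xbar (fe_fun T vbar))\<bar>" "0 < \<sigma>"
    and f: "f = (\<lambda>l. (1 / \<tau>) * (area T (\<lambda>i. xbar i + (\<tau> * l) *\<^sub>R vbar i) - area T (x (n - 1)))
               + (1 / \<tau>) * dissipation T \<tau> q x u n)"
    and \<gamma>: "0 \<le> \<gamma>" "\<gamma> \<le> 1/2"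
      "\<tau> * \<delta> * (3 * (4 * L2_norm_surf T xbar gradv / \<sigma>)\<^sup>2) = \<gamma> * (1 - \<gamma>)"
    and \<rho>: "\<rho> = \<delta> / (\<sigma> * (1 - \<gamma>))" "\<tau> * \<rho> * Linf_norm_surf T gradv \<le> 1/2"
  shows "\<exists>l. \<bar>l\<bar> \<le> \<rho> \<and>
             (\<exists>X. position_equations T \<tau> q x u v n l X) \<and>
             (\<forall>l'. \<bar>l'\<bar> \<le> \<rho> \<and> (\<exists>X. position_equations T \<tau> q x u v n l' X) \<longrightarrow> l' = l) \<and>
             (\<forall>X. position_equations T \<tau> q x u v n l X \<longrightarrow> area T X \<le> area T (x (n - 1))) \<and>
             simplified_newton f \<longlonglongrightarrow> l \<and>
             (\<forall>j. \<bar>simplified_newton f (Suc j) - l\<bar> \<le> \<gamma> * \<bar>simplified_newton f j - l\<bar>)"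
proof -
  let ?d = "surf_integral T xbar (surf_div T xbar (fe_fun T vbar))"
  let ?L = "L2_norm_surf T xbar gradv"
  define A where "A s = area T (\<lambda>i. xbar i + s *\<^sub>R vbar i)" for s
  have f_A: "f = (\<lambda>l. (1 / \<tau>) * (A (\<tau> * l) - area T (x (n - 1))) + (1 / \<tau>) * dissipation T \<tau> q x u n)"
    by (simp add: f A_def)
  have "(A has_real_derivative ?d) (at (\<tau> * 0))"
    unfolding A_def using area_has_derivative[OF reg] by simp
  \<comment> \<open>The inner factor \<tau> cancels against 1/\<tau> in \<open>f\<close>, so
    \<open>deriv f 0\<close> is the signed integral of the divergence.\<close>
  from DERIV_chain2[where g = "\<lambda>l. \<tau> * l" and x = 0, OF this, of \<tau>]
  have "((\<lambda>l. A (\<tau> * l)) has_real_derivative ?d * \<tau>) (at 0)"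
    by (auto intro!: derivative_eq_intros)
  then have "(f has_real_derivative ?d) (at 0)"
    unfolding f_A using \<tau> by (auto intro!: derivative_eq_intros)
  then have deriv: "deriv f 0 = ?d" by (rule DERIV_imp_deriv)
  have f0: "\<bar>f 0\<bar> = \<delta>" by (simp add: f \<delta>)
  have \<gamma>1: "1 - \<gamma> > 0" using \<gamma> by simp
  \<comment> \<open>This is where 48 = 3 * 4^2 meets the definition of \<eta>: dividing the equation
    for \<gamma> (1 - \<gamma>) by 1 - \<gamma> turns \<delta> into \<rho> and identifies the
    Lipschitz constant of the area as \<gamma> \<sigma>.\<close>
  have rate: "48 * \<tau> * \<rho> * ?L\<^sup>2 = \<gamma> * \<sigma>"
  proof -
    have "48 * \<tau> * \<delta> * ?L\<^sup>2 = \<sigma>\<^sup>2 * (\<gamma> * (1 - \<gamma>))"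
      using \<sigma> unfolding \<gamma>(3)[symmetric] by (simp add: power_divide power_mult_distrib)
    then show ?thesis
      using \<sigma>(2) \<gamma>1 by (simp add: \<rho>(1) field_simps power2_eq_square)
  qed
  have lip: "\<bar>f s - f r - ?d * (s - r)\<bar> \<le> \<gamma> * \<sigma> * \<bar>s - r\<bar>" if s: "\<bar>s\<bar> \<le> \<rho>" and r: "\<bar>r\<bar> \<le> \<rho>" for s r
  proof -
    have "\<bar>A (\<tau> * s) - A (\<tau> * r) - (\<tau> * s - \<tau> * r) * ?d\<bar> \<le> 48 * (\<tau> * \<rho>) * \<bar>\<tau> * s - \<tau> * r\<bar> * ?L\<^sup>2"
      unfolding A_def gradv
      by (rule area_expansion[OF reg]) (use s r \<tau> \<rho>(2) gradv in \<open>simp_all add: abs_mult\<close>)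
    also have "\<dots> = \<tau> * (\<gamma> * \<sigma> * \<bar>s - r\<bar>)"
      using \<tau> unfolding rate[symmetric] by (simp add: abs_mult flip: right_diff_distrib)
    finally have "\<bar>A (\<tau> * s) - A (\<tau> * r) - (\<tau> * s - \<tau> * r) * ?d\<bar> \<le> \<tau> * (\<gamma> * \<sigma> * \<bar>s - r\<bar>)" .
    moreover have "A (\<tau> * s) - A (\<tau> * r) - (\<tau> * s - \<tau> * r) * ?d = \<tau> * (f s - f r - ?d * (s - r))"
      using \<tau> by (simp add: f_A field_simps)
    ultimately show ?thesis using \<tau> by (simp add: abs_mult)
  qed
  have "\<rho> = \<bar>f 0\<bar> / (\<sigma> * (1 - \<gamma>))" using f0 \<rho>(1) by simp
  from simplified_newton_converges[OF deriv \<sigma>(1)[symmetric] \<sigma>(2) \<gamma>(1) _ this lip] \<gamma>1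
  obtain l where l: "\<bar>l\<bar> \<le> \<rho>" "f l = 0" "\<forall>l'. \<bar>l'\<bar> \<le> \<rho> \<and> f l' = 0 \<longrightarrow> l' = l"
    "simplified_newton f \<longlonglongrightarrow> l"
    "\<forall>j. \<bar>simplified_newton f (Suc j) - l\<bar> \<le> \<gamma> * \<bar>simplified_newton f j - l\<bar>"
    unfolding diff_gt_0_iff_gt by blast
  have root: "f l' = 0 \<longleftrightarrow> A (\<tau> * l') - area T (x (n - 1)) = - dissipation T \<tau> q x u n" for l'
    using \<tau> by (auto simp: f_A field_simps)
  have pos: "position_equations T \<tau> q x u v n l' X \<longleftrightarrow>
      (\<forall>i<nnodes T. X i = xbar i + (\<tau> * l') *\<^sub>R vbar i) \<and> f l' = 0" for l' X
    unfolding root A_def xbar vbar by (rule position_equations_iff[OF T \<tau>])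
  have "\<exists>X. position_equations T \<tau> q x u v n l X" using l(2) by (auto simp: pos)
  moreover have "area T X \<le> area T (x (n - 1))" if "position_equations T \<tau> q x u v n l X" for X
    using that dissipation_nonneg[of T \<tau> q x u n] by (simp add: position_equations_def)
  ultimately show ?thesis using l pos by blast
qed

theorem proposition5p1:
  shows "\<exists>c2::real. 0 < c2 \<and> c2 \<le> 4 \<and>
    (\<forall>(T::fe_mesh) (\<tau>::real) (q::nat) (n::nat)
       (x :: nat \<Rightarrow> nat \<Rightarrow> real^3) (u :: nat \<Rightarrow> nat \<Rightarrow> (real^3) \<times> real) (v :: nat \<Rightarrow> nat \<Rightarrow> real^3)
       (vbar :: nat \<Rightarrow> real^3) (xbar :: nat \<Rightarrow> real^3) (gradv :: nat \<Rightarrow> real^2 \<Rightarrow> real^3^3)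
       (\<delta>::real) (\<sigma>::real) (\<eta>::real) (f :: real \<Rightarrow> real).
      closed_triangulation T \<longrightarrow>
      0 < \<tau> \<longrightarrow> 2 \<le> q \<longrightarrow> q \<le> 5 \<longrightarrow> q \<le> n \<longrightarrow>
      scheme_until T \<tau> q x u v n \<longrightarrow>
      vbar = time_average \<tau> q v n \<longrightarrow>
      xbar = (\<lambda>i. x (n - 1) i + \<tau> *\<^sub>R vbar i) \<longrightarrow>
      regular_surface T xbar \<longrightarrow>
      gradv = surf_grad_vec T xbar (fe_fun T vbar) \<longrightarrow>
      \<delta> = \<bar>(1 / \<tau>) * (area T xbar - area T (x (n - 1))) + (1 / \<tau>) * dissipation T \<tau> q x u n\<bar> \<longrightarrow>
      \<sigma> = \<bar>surf_integral T xbar (surf_div T xbar (fe_fun T vbar))\<bar> \<longrightarrow>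
      0 < \<sigma> \<longrightarrow>
      \<eta> = 3 * (c2 * L2_norm_surf T xbar gradv / \<sigma>)\<^sup>2 \<longrightarrow>
      f = (\<lambda>l. (1 / \<tau>) * (area T (\<lambda>i. xbar i + (\<tau> * l) *\<^sub>R vbar i) - area T (x (n - 1)))
               + (1 / \<tau>) * dissipation T \<tau> q x u n) \<longrightarrow>
      \<tau> * \<delta> * \<eta> \<le> 1/4 \<longrightarrow>
      (\<exists>\<gamma>. 0 \<le> \<gamma> \<and> \<gamma> \<le> 1/2 \<and> (0 < \<delta> \<longrightarrow> 0 < \<gamma>) \<and> \<tau> * \<delta> * \<eta> = \<gamma> * (1 - \<gamma>)) \<and>
      (\<forall>\<gamma> \<rho>. 0 \<le> \<gamma> \<longrightarrow> \<gamma> \<le> 1/2 \<longrightarrow> \<tau> * \<delta> * \<eta> = \<gamma> * (1 - \<gamma>) \<longrightarrow>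
        \<rho> = \<delta> / (\<sigma> * (1 - \<gamma>)) \<longrightarrow>
        \<tau> * \<rho> * Linf_norm_surf T gradv \<le> 1/2 \<longrightarrow>
        (\<exists>l. \<bar>l\<bar> \<le> \<rho> \<and>
             (\<exists>X. position_equations T \<tau> q x u v n l X) \<and>
             (\<forall>l'. \<bar>l'\<bar> \<le> \<rho> \<and> (\<exists>X. position_equations T \<tau> q x u v n l' X) \<longrightarrow> l' = l) \<and>
             (\<forall>X. position_equations T \<tau> q x u v n l X \<longrightarrow> area T X \<le> area T (x (n - 1))) \<and>
             simplified_newton f \<longlonglongrightarrow> l \<and>
             (\<forall>j. \<bar>simplified_newton f (Suc j) - l\<bar> \<le> \<gamma> * \<bar>simplified_newton f j - l\<bar>))))"
proof (rule exI[of _ 4], intro conjI allI impI)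
  fix T :: fe_mesh and \<tau> :: real and q n :: nat and x v :: "nat \<Rightarrow> nat \<Rightarrow> real^3"
    and u :: "nat \<Rightarrow> nat \<Rightarrow> (real^3) \<times> real" and vbar xbar :: "nat \<Rightarrow> real^3"
    and gradv :: "nat \<Rightarrow> real^2 \<Rightarrow> real^3^3" and \<delta> \<sigma> \<eta> :: real and f :: "real \<Rightarrow> real"
  assume T: "closed_triangulation T" and \<tau>: "0 < \<tau>"
    and vbar: "vbar = time_average \<tau> q v n"
    and xbar: "xbar = (\<lambda>i. x (n - 1) i + \<tau> *\<^sub>R vbar i)"
    and reg: "regular_surface T xbar"
    and gradv: "gradv = surf_grad_vec T xbar (fe_fun T vbar)"
    and \<delta>: "\<delta> = \<bar>(1 / \<tau>) * (area T xbar - area T (x (n - 1))) + (1 / \<tau>) * dissipation T \<tau> q x u n\<bar>"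
    and \<sigma>: "\<sigma> = \<bar>surf_integral T xbar (surf_div T xbar (fe_fun T vbar))\<bar>" "0 < \<sigma>"
    and \<eta>: "\<eta> = 3 * (4 * L2_norm_surf T xbar gradv / \<sigma>)\<^sup>2"
    and f: "f = (\<lambda>l. (1 / \<tau>) * (area T (\<lambda>i. xbar i + (\<tau> * l) *\<^sub>R vbar i) - area T (x (n - 1)))
               + (1 / \<tau>) * dissipation T \<tau> q x u n)"
    and small: "\<tau> * \<delta> * \<eta> \<le> 1/4"
  \<comment> \<open>Positivity of \<eta> makes \<tau> \<delta> \<eta> positive whenever \<delta> is,
    which rules out \<gamma> = 0 in that case.\<close>
  have "L2_norm_surf T xbar gradv \<noteq> 0"
    unfolding gradv using \<sigma> by (intro L2_norm_surf_grad_nonzero[OF reg]) auto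
  then have "0 < \<eta>" using \<sigma> by (simp add: \<eta>)
  moreover have "0 \<le> \<delta>" by (simp add: \<delta>)
  moreover obtain \<gamma> where "0 \<le> \<gamma>" "\<gamma> \<le> 1/2" "\<tau> * \<delta> * \<eta> = \<gamma> * (1 - \<gamma>)"
    using ex_quadratic_root[OF _ small] \<tau> calculation by auto
  ultimately show "\<exists>\<gamma>. 0 \<le> \<gamma> \<and> \<gamma> \<le> 1/2 \<and> (0 < \<delta> \<longrightarrow> 0 < \<gamma>) \<and> \<tau> * \<delta> * \<eta> = \<gamma> * (1 - \<gamma>)"
    using \<tau> by (intro exI[of _ \<gamma>]) (auto simp: less_le)
  fix \<gamma> \<rho> :: real
  assume "0 \<le> \<gamma>" "\<gamma> \<le> 1/2" "\<tau> * \<delta> * \<eta> = \<gamma> * (1 - \<gamma>)" "\<rho> = \<delta> / (\<sigma> * (1 - \<gamma>))"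
    "\<tau> * \<rho> * Linf_norm_surf T gradv \<le> 1/2"
  then show "\<exists>l. \<bar>l\<bar> \<le> \<rho> \<and>
             (\<exists>X. position_equations T \<tau> q x u v n l X) \<and>
             (\<forall>l'. \<bar>l'\<bar> \<le> \<rho> \<and> (\<exists>X. position_equations T \<tau> q x u v n l' X) \<longrightarrow> l' = l) \<and>
             (\<forall>X. position_equations T \<tau> q x u v n l X \<longrightarrow> area T X \<le> area T (x (n - 1))) \<and>
             simplified_newton f \<longlonglongrightarrow> l \<and>
             (\<forall>j. \<bar>simplified_newton f (Suc j) - l\<bar> \<le> \<gamma> * \<bar>simplified_newton f j - l\<bar>)"
    unfolding \<eta> by (intro multiplier_exists_unique[OF T \<tau> vbar xbar reg gradv \<delta> \<sigma> f])
qed (rule order.refl | simp)+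

end
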